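(* Let $\xi=(\xi_1,\xi_2,\ldots)$ be a swap-invariant sequence of positive random variables, and put $\tilde\xi=(\xi_2/\xi_1,\xi_3/\xi_1,\ldots)$. Then $$\frac1n\sum_{i=1}^n\xi_i\ \to\ \frac{\xi_1}{\mathbf{E}(\xi_1\mid\mathcal{E}_{\tilde\xi})}\,\mathbf{E}(\xi_2\mid\mathcal{E}_{\tilde\xi})\qquad\text{almost surely and in }L^1\text{ as }n\to\infty .$$
   Context: Two integrable random vectors $\xi,\xi^*$ in $\mathbb{R}^d$ are zonoid equivalent if $\mathbf{E}|\langle u,\xi\rangle|=\mathbf{E}|\langle u,\xi^*\rangle|$ for all $u\in\mathbb{R}^d$. An integrable random vector is swap-invariant if all random vectors obtained by permutations of its coordinates are zonoid equivalent. A sequence of integrable random variables is swap-invariant if all its finite subsequences are swap-invariant (as random vectors). Positive means (almost surely) strictly positive. For a random sequence $\zeta=(\zeta_1,\zeta_2,\ldots)$, $\mathcal{E}_\zeta$ denotes its permutation-invariant $\sigma$-field, i.e. the $\sigma$-field of events $\{\zeta\in B\}$ with $B\subset\mathbb{R}^\infty$ measurable and invariant under all finite permutations of coordinates. *)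

theory Defs
  imports "HOL-Probability.Probability" "HOL-Combinatorics.Permutations"
begin

text \<open>
  A random vector in d-dimensional Euclidean space is a family \<open>X\<close> of random variables of which
  only the coordinates \<open>X i\<close> with \<open>i < d\<close> matter: the dimension is a number rather than a type,
  since below it is quantified over.
\<close>

definition integrable_vec :: "'a measure \<Rightarrow> nat \<Rightarrow> (nat \<Rightarrow> 'a \<Rightarrow> real) \<Rightarrow> bool" where
  "integrable_vec M d X \<longleftrightarrow> (\<forall>i<d. integrable M (X i))"

definition zonoid_equivalent ::
    "nat \<Rightarrow> 'a measure \<Rightarrow> (nat \<Rightarrow> 'a \<Rightarrow> real) \<Rightarrow> 'b measure \<Rightarrow> (nat \<Rightarrow> 'b \<Rightarrow> real) \<Rightarrow> bool" where
  "zonoid_equivalent d M X N Y \<longleftrightarrow>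
     integrable_vec M d X \<and> integrable_vec N d Y \<and>
     (\<forall>u :: nat \<Rightarrow> real.
        (\<integral>\<omega>. \<bar>\<Sum>i<d. u i * X i \<omega>\<bar> \<partial>M) = (\<integral>\<omega>. \<bar>\<Sum>i<d. u i * Y i \<omega>\<bar> \<partial>N))"

definition swap_invariant_vec :: "'a measure \<Rightarrow> nat \<Rightarrow> (nat \<Rightarrow> 'a \<Rightarrow> real) \<Rightarrow> bool" where
  "swap_invariant_vec M d X \<longleftrightarrow>
     integrable_vec M d X \<and>
     (\<forall>\<pi> \<sigma>. \<pi> permutes {..<d} \<longrightarrow> \<sigma> permutes {..<d} \<longrightarrow>
        zonoid_equivalent d M (\<lambda>i. X (\<pi> i)) M (\<lambda>i. X (\<sigma> i)))"

definition swap_invariant_seq :: "'a measure \<Rightarrow> (nat \<Rightarrow> 'a \<Rightarrow> real) \<Rightarrow> bool" where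
  "swap_invariant_seq M X \<longleftrightarrow>
     (\<forall>i. integrable M (X i)) \<and>
     (\<forall>d k. strict_mono_on {..<d} k \<longrightarrow> swap_invariant_vec M d (\<lambda>i. X (k i)))"

definition perm_invariant_sets :: "(nat \<Rightarrow> real) set set" where
  "perm_invariant_sets =
     {B \<in> sets (\<Pi>\<^sub>M i\<in>(UNIV :: nat set). borel).
        \<forall>\<pi> S. finite S \<longrightarrow> \<pi> permutes S \<longrightarrow> (\<forall>x. (\<lambda>i. x (\<pi> i)) \<in> B \<longleftrightarrow> x \<in> B)}"

definition perm_invariant_field :: "'a measure \<Rightarrow> (nat \<Rightarrow> 'a \<Rightarrow> real) \<Rightarrow> 'a measure" where
  "perm_invariant_field M Z =
     sigma (space M) {(\<lambda>\<omega> i. Z i \<omega>) -` B \<inter> space M | B. B \<in> perm_invariant_sets}"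

lemma sigma_algebra_perm_invariant_sets: "sigma_algebra UNIV perm_invariant_sets"
proof -
  have U: "space (\<Pi>\<^sub>M i\<in>(UNIV :: nat set). (borel :: real measure)) = UNIV"
    by (simp add: space_PiM)
  show ?thesis
    unfolding sigma_algebra_iff2
  proof (intro conjI ballI allI impI)
    show "{} \<in> perm_invariant_sets"
      by (simp add: perm_invariant_sets_def)
    show "UNIV - B \<in> perm_invariant_sets" if "B \<in> perm_invariant_sets" for B
      using that sets.compl_sets[of B "\<Pi>\<^sub>M i\<in>(UNIV :: nat set). borel"]
      unfolding perm_invariant_sets_def U by blast
    show "(\<Union>n. A n) \<in> perm_invariant_sets" if "range A \<subseteq> perm_invariant_sets" for A :: "nat \<Rightarrow> _"
    proof -
      have "range A \<subseteq> sets (\<Pi>\<^sub>M i\<in>(UNIV :: nat set). borel)"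
        using that unfolding perm_invariant_sets_def by blast
      then have "(\<Union>n. A n) \<in> sets (\<Pi>\<^sub>M i\<in>(UNIV :: nat set). borel)"
        by (rule sets.countable_UN)
      then show ?thesis
        using that unfolding perm_invariant_sets_def by blast
    qed
  qed simp
qed

lemma space_perm_invariant_field [simp]: "space (perm_invariant_field M Z) = space M"
  unfolding perm_invariant_field_def by (rule space_measure_of) auto

text \<open>The generating family is already a \<open>\<sigma>\<close>-algebra.\<close>

lemma sets_perm_invariant_field:
  "sets (perm_invariant_field M Z) =
     {(\<lambda>\<omega> i. Z i \<omega>) -` B \<inter> space M | B. B \<in> perm_invariant_sets}"
proof -
  have "sets (perm_invariant_field M Z) =
      sigma_sets (space M) {(\<lambda>\<omega> i. Z i \<omega>) -` B \<inter> space M | B. B \<in> perm_invariant_sets}"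
    unfolding perm_invariant_field_def by (rule sets_measure_of) auto
  also have "\<dots> = {(\<lambda>\<omega> i. Z i \<omega>) -` B \<inter> space M | B. B \<in> sigma_sets UNIV perm_invariant_sets}"
    by (rule sigma_sets_vimage_commute[symmetric]) auto
  finally show ?thesis
    by (simp add: sigma_algebra.sigma_sets_eq[OF sigma_algebra_perm_invariant_sets])
qed

lemma subalgebra_perm_invariant_field:
  assumes [measurable]: "\<And>i. Z i \<in> borel_measurable M"
  shows "subalgebra M (perm_invariant_field M Z)"
proof -
  have "(\<lambda>\<omega> i. Z i \<omega>) \<in> measurable M (\<Pi>\<^sub>M i\<in>(UNIV :: nat set). borel)"
    by (rule measurable_PiM_single') auto
  then show ?thesis
    unfolding subalgebra_def sets_perm_invariant_field
    by (auto simp: perm_invariant_sets_def intro: measurable_sets)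
qed

definition tendsto_L1 :: "'a measure \<Rightarrow> (nat \<Rightarrow> 'a \<Rightarrow> real) \<Rightarrow> ('a \<Rightarrow> real) \<Rightarrow> bool" where
  "tendsto_L1 M X Y \<longleftrightarrow>
     (\<forall>n. integrable M (X n)) \<and> integrable M Y \<and>
     (\<lambda>n. \<integral>\<omega>. \<bar>X n \<omega> - Y \<omega>\<bar> \<partial>M) \<longlonglongrightarrow> 0"

end

theory Submission
  imports Defs
begin

text \<open>
  Weight the underlying measure by \<open>\<xi>\<^sub>1\<close>. The Laplace transform of the law of the ratios \<open>\<xi>\<^sub>i / \<xi>\<^sub>1\<close> under
  the weighted measure is a mixture of the integrals \<open>E (a \<xi>\<^sub>1 - \<langle>k, \<xi>\<rangle>)\<^sup>+\<close>, which swap-invariance makes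
  symmetric in the other coordinates. So the ratios are exchangeable, hence stationary, under the weighted
  measure, and Birkhoff's theorem yields convergence of their averages, almost surely and in \<open>L\<^sup>1\<close>. The
  limit is permutation invariant, and by exchangeability it is the weighted conditional expectation of
  \<open>\<xi>\<^sub>2 / \<xi>\<^sub>1\<close>, which Bayes' formula turns into \<open>E(\<xi>\<^sub>2 | \<E>) / E(\<xi>\<^sub>1 | \<E>)\<close>.
\<close>

section \<open>Birkhoff's ergodic theorem\<close>

text \<open>Absolute moments of linear forms control only expectations of functions of \<xi> that
  are homogeneous of degree 1, so \<xi> itself need not be exchangeable. Such a function is
  \<open>\<xi> 0\<close> times a function of the ratios by \<open>\<xi> 0\<close>; this is where the
  density and the ratios come from. Permutations of \<xi> that fix coordinate 0 leave density and
  denominator alone and permute the ratios.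

  Positivity makes the Laplace transform available: for y \<ge> 0, exp (- y) is the integral of (a -
  y)^+ exp (- a) over a \<ge> 0, a mixture of hinge functions with nonnegative weights, so Tonelli's
  theorem suffices.

  Since \<open>\<xi> 0\<close> is almost surely positive, the weighted and the original measure have
  the same null sets, and the weighted L^1 norm of a function of the ratios is the original L^1 norm
  of its product with \<open>\<xi> 0\<close>. Both modes of convergence therefore carry back without
  loss. Indices in the code start at 0.\<close>

lemma integrable_indicator_mult:
  fixes f :: "'a \<Rightarrow> real"
  shows "A \<in> sets M \<Longrightarrow> integrable M f \<Longrightarrow> integrable M (\<lambda>x. indicator A x * f x)"
  using integrable_mult_indicator[of A M f] by simp

text \<open>Finite rather than probability: the weighted law to which this is applied has total mass
  equal to the expectation of \<open>\<xi> 0\<close>, not 1.\<close>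

locale measure_preserving_map = finite_measure M for M :: "'a measure" +
  fixes T :: "'a \<Rightarrow> 'a"
  assumes T_measurable [measurable]: "T \<in> M \<rightarrow>\<^sub>M M"
    and distr_T: "distr M M T = M"
begin

lemma T_space: "x \<in> space M \<Longrightarrow> T x \<in> space M"
  using measurable_space[OF T_measurable] .

lemma T_pow_measurable [measurable]: "T ^^ n \<in> M \<rightarrow>\<^sub>M M"
  by (induction n) (auto intro: measurable_compose simp: comp_def)

lemma distr_T_pow: "distr M M (T ^^ n) = M"
proof (induction n)
  case (Suc n)
  have "distr M M (T ^^ Suc n) = distr (distr M M (T ^^ n)) M T"
    unfolding funpow.simps by (rule distr_distr[symmetric]) auto
  then show ?case
    by (simp only: Suc distr_T)
qed (simp add: distr_id2 id_def)

lemma integral_T_pow: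
  fixes g :: "'a \<Rightarrow> real"
  assumes "integrable M g"
  shows "integrable M (\<lambda>x. g ((T ^^ n) x))" "(\<integral>x. g ((T ^^ n) x) \<partial>M) = (\<integral>x. g x \<partial>M)"
proof -
  have "integrable (distr M M (T ^^ n)) g"
    using assms by (simp add: distr_T_pow)
  then show "integrable M (\<lambda>x. g ((T ^^ n) x))"
    by (rule integrable_distr[rotated]) simp
  have "(\<integral>x. g x \<partial>distr M M (T ^^ n)) = (\<integral>x. g ((T ^^ n) x) \<partial>M)"
    using assms by (intro integral_distr) auto
  then show "(\<integral>x. g ((T ^^ n) x) \<partial>M) = (\<integral>x. g x \<partial>M)"
    by (simp add: distr_T_pow)
qed

definition birkhoff_sum :: "('a \<Rightarrow> real) \<Rightarrow> nat \<Rightarrow> 'a \<Rightarrow> real" where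
  "birkhoff_sum g n x = (\<Sum>i<n. g ((T ^^ i) x))"

lemma birkhoff_sum_measurable [measurable]:
  "g \<in> borel_measurable M \<Longrightarrow> birkhoff_sum g n \<in> borel_measurable M"
  unfolding birkhoff_sum_def[abs_def]
  by (intro borel_measurable_sum measurable_compose[OF T_pow_measurable])

lemma birkhoff_sum_Suc: "birkhoff_sum g (Suc n) x = g x + birkhoff_sum g n (T x)"
  by (simp add: birkhoff_sum_def sum.lessThan_Suc_shift funpow_swap1 del: sum.lessThan_Suc)

lemma integral_birkhoff_sum:
  assumes "integrable M g"
  shows "integrable M (birkhoff_sum g n)" "(\<integral>x. birkhoff_sum g n x \<partial>M) = n * (\<integral>x. g x \<partial>M)"
  using integral_T_pow[OF assms] by (auto simp: birkhoff_sum_def[abs_def])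

text \<open>This is the maximum of \<open>birkhoff_sum g k x\<close> over k \<le> n, the empty sum
  included. The recursive form makes Garsia's inequality immediate wherever the maximum is
  positive.\<close>

primrec sum_max :: "('a \<Rightarrow> real) \<Rightarrow> nat \<Rightarrow> 'a \<Rightarrow> real" where
  "sum_max g 0 x = 0"
| "sum_max g (Suc n) x = max 0 (g x + sum_max g n (T x))"

lemma sum_max_nonneg: "0 \<le> sum_max g n x"
  by (cases n) auto

lemma sum_max_mono: "sum_max g n x \<le> sum_max g (Suc n) x"
proof (induction n arbitrary: x)
  case (Suc n)
  show ?case
    using Suc[of "T x"] unfolding sum_max.simps(2) by (intro max.mono add_left_mono order_refl)
qed (simp add: sum_max_nonneg)

lemma birkhoff_sum_le_sum_max: "birkhoff_sum g n x \<le> sum_max g n x"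
proof (induction n arbitrary: x)
  case (Suc n)
  show ?case
    using Suc[of "T x"] by (simp add: birkhoff_sum_Suc)
qed (simp add: birkhoff_sum_def)

lemma integrable_sum_max:
  assumes "integrable M g"
  shows "integrable M (sum_max g n)"
proof (induction n)
  case (Suc n)
  have "integrable M (\<lambda>x. sum_max g n (T x))"
    using integral_T_pow(1)[OF Suc, of 1] by simp
  then show ?case
    using assms by (simp add: sum_max.simps[abs_def])
qed (simp add: sum_max.simps[abs_def])

text \<open>Garsia's argument: where the maximum \<open>m\<close> of the first sums is positive, \<open>g \<ge> m - m \<circ> T\<close>,
  and the right-hand side integrates to at least 0.\<close>

lemma maximal_ergodic:
  assumes g: "integrable M g"
    and A [measurable]: "A \<in> sets M"
    and inv: "\<And>x. x \<in> space M \<Longrightarrow> T x \<in> A \<longleftrightarrow> x \<in> A"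
    and pos: "\<And>x. x \<in> A \<Longrightarrow> \<exists>n. 0 < birkhoff_sum g n x"
  shows "0 \<le> (\<integral>x. indicator A x * g x \<partial>M)"
proof -
  have [measurable]: "g \<in> borel_measurable M" "\<And>n. sum_max g n \<in> borel_measurable M"
    using g integrable_sum_max[OF g] by auto
  let ?A = "\<lambda>n. {x \<in> space M. x \<in> A \<and> 0 < sum_max g n x}"
  have nonneg: "0 \<le> (\<integral>x. indicator (?A n) x * g x \<partial>M)" for n
  proof -
    \<comment> \<open>The indicator of the invariant set \<open>A\<close> commutes with composition
      by \<open>T\<close>, so the argument can run inside \<open>A\<close>.\<close>
    let ?m = "\<lambda>x. indicator A x * sum_max g n x"
    have m: "integrable M ?m"
      using integrable_sum_max[OF g] by (intro integrable_indicator_mult) auto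
    have mT: "integrable M (\<lambda>x. ?m (T x))" "(\<integral>x. ?m (T x) \<partial>M) = (\<integral>x. ?m x \<partial>M)"
      using integral_T_pow[OF m, of 1] by auto
    have "0 = (\<integral>x. ?m x - ?m (T x) \<partial>M)"
      using m mT by simp
    also have "\<dots> \<le> (\<integral>x. indicator (?A n) x * g x \<partial>M)"
    proof (rule integral_mono)
      show "integrable M (\<lambda>x. indicator (?A n) x * g x)"
        using g by (intro integrable_indicator_mult) auto
      show "?m x - ?m (T x) \<le> indicator (?A n) x * g x" if x: "x \<in> space M" for x
      proof (cases "x \<in> A")
        case True
        show ?thesis
        proof (cases "0 < sum_max g n x")
          case pos: True
          then obtain k where k: "n = Suc k"
            by (cases n) auto
          \<comment> \<open>A positive maximum equals \<open>g x + sum_max g k (T x)\<close> by the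
            recursion; monotonicity absorbs the lag between \<open>k\<close> and
            \<open>n\<close>.\<close>
          have "sum_max g n x \<le> g x + sum_max g n (T x)"
            using pos sum_max_mono[of g k "T x"] by (auto simp: k)
          then show ?thesis
            using True x inv[OF x] pos by (simp add: indicator_def)
        next
          case False
          then show ?thesis
            using True x inv[OF x] sum_max_nonneg[of g n x] sum_max_nonneg[of g n "T x"]
            by (simp add: indicator_def)
        qed
      next
        case False
        then show ?thesis
          using inv[OF x] by (simp add: indicator_def)
      qed
    qed (use m mT in auto)
    finally show ?thesis .
  qed
  have "(\<lambda>n. \<integral>x. indicator (?A n) x * g x \<partial>M) \<longlonglongrightarrow> (\<integral>x. indicator A x * g x \<partial>M)"
  proof (rule integral_dominated_convergence[where w="\<lambda>x. \<bar>g x\<bar>"])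
    show "AE x in M. (\<lambda>n. indicator (?A n) x * g x) \<longlonglongrightarrow> indicator A x * g x"
    proof (rule AE_I2, cases)
      fix x assume x: "x \<in> space M" "x \<in> A"
      obtain N where "0 < birkhoff_sum g N x"
        using pos[OF x(2)] by auto
      then have N: "0 < sum_max g N x"
        using birkhoff_sum_le_sum_max[of g N x] by linarith
      have "0 < sum_max g n x" if "N \<le> n" for n
        using lift_Suc_mono_le[of "\<lambda>n. sum_max g n x", OF sum_max_mono that] N by linarith
      then show "(\<lambda>n. indicator (?A n) x * g x) \<longlonglongrightarrow> indicator A x * g x"
        using x by (intro tendsto_eventually eventually_sequentiallyI[of N]) (auto simp: indicator_def)
    qed (auto simp: indicator_def)
  qed (use g in \<open>auto simp: indicator_def\<close>)
  then show ?thesis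
    by (rule LIMSEQ_le_const) (use nonneg in auto)
qed


section \<open>Almost sure convergence of ergodic averages\<close>

definition birkhoff_avg :: "('a \<Rightarrow> real) \<Rightarrow> nat \<Rightarrow> 'a \<Rightarrow> real" where
  "birkhoff_avg g n x = birkhoff_sum g n x / n"

lemma birkhoff_avg_measurable [measurable]:
  "g \<in> borel_measurable M \<Longrightarrow> birkhoff_avg g n \<in> borel_measurable M"
  unfolding birkhoff_avg_def[abs_def] by (intro borel_measurable_divide birkhoff_sum_measurable) auto

text \<open>Unboundedness of the sums stands in for a condition on the limsup of the averages.
  Passing from x to T x changes the sums only by the finite amount \<open>g x\<close>, so the set is
  invariant at every point of the space, as the maximal ergodic theorem demands.\<close>

definition unbounded_drift :: "('a \<Rightarrow> real) \<Rightarrow> 'a set" where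
  "unbounded_drift g = {x \<in> space M. \<forall>K::nat. \<exists>n. K < birkhoff_sum g n x}"

lemma sets_unbounded_drift [measurable]:
  "g \<in> borel_measurable M \<Longrightarrow> unbounded_drift g \<in> sets M"
  unfolding unbounded_drift_def by measurable

lemma unbounded_drift_T: 
  assumes "x \<in> space M"
  shows "T x \<in> unbounded_drift g \<longleftrightarrow> x \<in> unbounded_drift g"
proof -
  have "\<exists>n. K < birkhoff_sum g n x" if *: "\<And>K::nat. \<exists>n. K < birkhoff_sum g n (T x)" for K :: nat
  proof -
    obtain n where "nat \<lceil>K - g x\<rceil> < birkhoff_sum g n (T x)"
      using * by blast
    then show ?thesis
      by (intro exI[of _ "Suc n"]) (simp add: birkhoff_sum_Suc, linarith)
  qed
  moreover have "\<exists>n. K < birkhoff_sum g n (T x)" if *: "\<And>K::nat. \<exists>n. K < birkhoff_sum g n x" for K :: nat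
  proof -
    obtain n where n: "nat \<lceil>K + g x\<rceil> < birkhoff_sum g n x"
      using * by blast
    \<comment> \<open>The empty sum 0 cannot exceed a natural number, so there is a first term to
      split off.\<close>
    then obtain m where "n = Suc m"
      by (cases n) (auto simp: birkhoff_sum_def)
    then show ?thesis
      using n by (intro exI[of _ m]) (simp add: birkhoff_sum_Suc, linarith)
  qed
  ultimately show ?thesis
    using assms by (auto simp: unbounded_drift_def T_space)
qed

lemma integral_unbounded_drift:
  assumes g: "integrable M g" and A: "A \<in> sets M" "A \<subseteq> unbounded_drift g"
    and inv: "\<And>x. x \<in> space M \<Longrightarrow> T x \<in> A \<longleftrightarrow> x \<in> A"
  shows "0 \<le> (\<integral>x. indicator A x * g x \<partial>M)"
proof (rule maximal_ergodic[OF g A(1) inv])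
  show "\<exists>n. 0 < birkhoff_sum g n x" if "x \<in> A" for x
    using that A(2) by (auto simp: unbounded_drift_def dest!: subsetD spec[of _ "0::nat"])
qed

text \<open>The maximal ergodic theorem applies on the intersection of the two sets to both f - b
  and a - f. Adding the two inequalities leaves (a - b) times its measure, which can be nonnegative
  only if the measure is 0. The form \<open>- f x - (- a)\<close> is the first one with -f and -a in
  place of f and b, so the same lemmas serve both sides.\<close>

lemma AE_not_oscillating:
  assumes f: "integrable M f" and "a < b"
  shows "AE x in M. \<not> (x \<in> unbounded_drift (\<lambda>x. f x - b) \<and> x \<in> unbounded_drift (\<lambda>x. - f x - (- a)))"
proof -
  let ?A = "unbounded_drift (\<lambda>x. f x - b) \<inter> unbounded_drift (\<lambda>x. - f x - (- a))"
  have [measurable]: "f \<in> borel_measurable M"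
    using f by auto
  have A [measurable]: "?A \<in> sets M"
    by measurable
  have int: "integrable M (\<lambda>x. indicator ?A x * (f x - b))" "integrable M (\<lambda>x. indicator ?A x * (- f x - (- a)))"
    by (rule integrable_indicator_mult; use f in auto)+
  have "0 \<le> (\<integral>x. indicator ?A x * (f x - b) \<partial>M)"
    using f by (intro integral_unbounded_drift) (auto simp: unbounded_drift_T)
  moreover have "0 \<le> (\<integral>x. indicator ?A x * (- f x - (- a)) \<partial>M)"
    using f by (intro integral_unbounded_drift) (auto simp: unbounded_drift_T)
  ultimately have "0 \<le> (\<integral>x. indicator ?A x * (f x - b) + indicator ?A x * (- f x - (- a)) \<partial>M)"
    using int by simp
  also have "\<dots> = (\<integral>x. (a - b) * indicator ?A x \<partial>M)"
    by (intro Bochner_Integration.integral_cong) (auto simp: algebra_simps)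
  also have "\<dots> = (a - b) * measure M ?A"
    using A by simp
  finally have "measure M ?A = 0"
    using \<open>a < b\<close> by (simp add: zero_le_mult_iff measure_le_0_iff)
  then have "?A \<in> null_sets M"
    using A by (simp add: null_sets_def emeasure_eq_measure)
  then show ?thesis
    using AE_not_in by fastforce
qed

text \<open>This excludes infinite limits. On the invariant set where every level b fails, the
  integral of f is at least b times the measure of the set for all b, so the measure is 0.\<close>

lemma AE_bounded_drift:
  assumes f: "integrable M f"
  shows "AE x in M. \<exists>b::nat. x \<notin> unbounded_drift (\<lambda>x. f x - b)"
proof -
  define A where "A = space M \<inter> (\<Inter>b::nat. unbounded_drift (\<lambda>x. f x - b))"
  have [measurable]: "f \<in> borel_measurable M"
    using f by auto
  have A [measurable]: "A \<in> sets M"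
    unfolding A_def by measurable
  have le: "b * measure M A \<le> (\<integral>x. indicator A x * f x \<partial>M)" for b :: nat
  proof -
    have int: "integrable M (\<lambda>x. indicator A x * f x)"
      using A f by (rule integrable_indicator_mult)
    have "0 \<le> (\<integral>x. indicator A x * (f x - b) \<partial>M)"
      using f by (intro integral_unbounded_drift) (auto simp: A_def unbounded_drift_T T_space)
    also have "\<dots> = (\<integral>x. indicator A x * f x - real b * indicat_real A x \<partial>M)"
      by (intro Bochner_Integration.integral_cong) (auto simp: algebra_simps)
    also have "\<dots> = (\<integral>x. indicator A x * f x \<partial>M) - b * measure M A"
      using int A integrable_const_bound[of "indicat_real A" 1] by simp
    finally show ?thesis
      by simp
  qed
  have "measure M A = 0"
  proof (rule ccontr)
    assume "measure M A \<noteq> 0"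
    then have "0 < measure M A"
      by (simp add: order.not_eq_order_implies_strict)
    then obtain b :: nat where "(\<integral>x. indicator A x * f x \<partial>M) < b * measure M A"
      using reals_Archimedean3 by blast
    with le[of b] show False
      by simp
  qed
  then have "A \<in> null_sets M"
    using A by (simp add: null_sets_def emeasure_eq_measure)
  from AE_not_in[OF this] show ?thesis
    by (auto elim!: eventually_mono simp: A_def)
qed

text \<open>An average above c puts the sum of f - b above n (c - b), and this happens for
  arbitrarily large n. The strict gap between b and c is what turns frequency into
  unboundedness.\<close>

lemma unbounded_driftI:
  assumes x: "x \<in> space M" and freq: "\<exists>\<^sub>F n in sequentially. c < birkhoff_avg f n x" and "b < c"
  shows "x \<in> unbounded_drift (\<lambda>x. f x - b)"
  unfolding unbounded_drift_def
proof (intro CollectI conjI x allI)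
  fix K :: nat
  obtain N :: nat where N: "K < N * (c - b)"
    using reals_Archimedean3[of "c - b"] \<open>b < c\<close> by auto
  have "\<exists>\<^sub>F n in sequentially. c < birkhoff_avg f n x \<and> max 1 N \<le> n"
    using freq eventually_ge_at_top by (rule frequently_eventually_frequently)
  then obtain n where n: "c < birkhoff_avg f n x" "max 1 N \<le> n"
    using frequently_ex by blast
  have "birkhoff_sum (\<lambda>x. f x - b) n x = n * (birkhoff_avg f n x - b)"
    using n(2) by (auto simp: birkhoff_sum_def birkhoff_avg_def sum_subtractf field_simps)
  moreover have "n * (c - b) \<le> n * (birkhoff_avg f n x - b)"
    using n by (intro mult_left_mono) auto
  moreover have "N * (c - b) \<le> n * (c - b)"
    using n \<open>b < c\<close> by (intro mult_right_mono) auto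
  ultimately show "\<exists>n. K < birkhoff_sum (\<lambda>x. f x - b) n x"
    using N by (intro exI[of _ n]) linarith
qed

lemma AE_convergent_birkhoff_avg:
  assumes f: "integrable M f"
  shows "AE x in M. convergent (\<lambda>n. birkhoff_avg f n x)"
proof -
  have neg: "birkhoff_avg (\<lambda>x. - f x) n x = - birkhoff_avg f n x" for n x
    by (simp add: birkhoff_avg_def birkhoff_sum_def sum_negf)
  have "AE x in M. \<forall>a b::rat. a < b \<longrightarrow>
      \<not> (x \<in> unbounded_drift (\<lambda>x. f x - of_rat b) \<and> x \<in> unbounded_drift (\<lambda>x. - f x - (- of_rat a)))"
    unfolding AE_all_countable
  proof (intro allI)
    fix a b :: rat
    show "AE x in M. a < b \<longrightarrow>
      \<not> (x \<in> unbounded_drift (\<lambda>x. f x - of_rat b) \<and> x \<in> unbounded_drift (\<lambda>x. - f x - (- of_rat a)))"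
      using AE_not_oscillating[OF f, of "of_rat a" "of_rat b"] by (cases "a < b") (simp_all add: of_rat_less)
  qed
  moreover have "AE x in M. \<exists>b::nat. x \<notin> unbounded_drift (\<lambda>x. f x - b)"
    using f by (rule AE_bounded_drift)
  moreover have "AE x in M. \<exists>b::nat. x \<notin> unbounded_drift (\<lambda>x. - f x - b)"
    using f by (intro AE_bounded_drift) simp
  ultimately show ?thesis
    using AE_space
  proof eventually_elim
    case (elim x)
    let ?u = "\<lambda>n. ereal (birkhoff_avg f n x)"
    \<comment> \<open>Adding 1 supplies the strict gap required by \<open>unbounded_driftI\<close>;
      this bounds the limsup, and the same for -f bounds the liminf.\<close>
    obtain b where b: "x \<notin> unbounded_drift (\<lambda>x. f x - real b)"
      using elim by blast
    then have "\<forall>\<^sub>F n in sequentially. \<not> b + 1 < birkhoff_avg f n x"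
      using unbounded_driftI[OF elim(4), of "b + 1" f b] by (auto simp: frequently_def)
    then have "\<forall>\<^sub>F n in sequentially. ?u n \<le> ereal (b + 1)"
      by eventually_elim simp
    then have fin1: "limsup ?u \<le> ereal (b + 1)"
      by (rule Limsup_bounded)
    obtain b' where b': "x \<notin> unbounded_drift (\<lambda>x. - f x - real b')"
      using elim by blast
    then have "\<forall>\<^sub>F n in sequentially. \<not> b' + 1 < birkhoff_avg (\<lambda>x. - f x) n x"
      using unbounded_driftI[OF elim(4), of "b' + 1" "\<lambda>x. - f x" b'] by (auto simp: frequently_def)
    then have "\<forall>\<^sub>F n in sequentially. ereal (- (b' + 1)) \<le> ?u n"
      by eventually_elim (simp add: neg)
    then have fin2: "ereal (- (b' + 1)) \<le> liminf ?u"
      by (rule Liminf_bounded)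
    have le: "liminf ?u \<le> limsup ?u"
      by (rule Liminf_le_Limsup) simp
    have "\<not> liminf ?u < limsup ?u"
    proof
      assume "liminf ?u < limsup ?u"
      \<comment> \<open>Four rationals c < a < b < d are needed: c and d separate liminf from
        limsup, and each side gives up a gap, from d to b and from c to a, to
        \<open>unbounded_driftI\<close>. Rationals keep the exceptional null sets countable in
        number.\<close>
      then obtain c where c: "liminf ?u < ereal (of_rat c)" "ereal (of_rat c) < limsup ?u"
        using ereal_dense3 by blast
      then obtain d where d: "ereal (of_rat c) < ereal (of_rat d)" "ereal (of_rat d) < limsup ?u"
        using ereal_dense3 by blast
      then obtain a where a: "c < a" "a < d"
        using dense[of c d] by (auto simp: of_rat_less)
      then obtain b where b: "a < b" "b < d"
        using dense by blast
      note * = c a b d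
      have "\<exists>\<^sub>F n in sequentially. of_rat d < birkhoff_avg f n x"
      proof (rule ccontr)
        assume "\<not> ?thesis"
        then have "\<forall>\<^sub>F n in sequentially. ?u n \<le> ereal (of_rat d)"
          by (simp add: not_frequently not_less)
        then have "limsup ?u \<le> ereal (of_rat d)"
          by (rule Limsup_bounded)
        with * show False
          by simp
      qed
      then have 1: "x \<in> unbounded_drift (\<lambda>x. f x - of_rat b)"
        by (rule unbounded_driftI[OF elim(4)]) (simp add: of_rat_less *)
      have "\<exists>\<^sub>F n in sequentially. - of_rat c < birkhoff_avg (\<lambda>x. - f x) n x"
      proof (rule ccontr)
        assume "\<not> ?thesis"
        then have "\<forall>\<^sub>F n in sequentially. ereal (of_rat c) \<le> ?u n"
          by (simp add: not_frequently not_less neg)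
        then have "ereal (of_rat c) \<le> liminf ?u"
          by (rule Liminf_bounded)
        with * show False
          by simp
      qed
      then have 2: "x \<in> unbounded_drift (\<lambda>x. - f x - (- of_rat a))"
        by (rule unbounded_driftI[OF elim(4)]) (simp add: of_rat_less *)
      show False
        using 1 2 * elim(1) by blast
    qed
    with le have eq: "liminf ?u = limsup ?u"
      by simp
    moreover obtain l where "limsup ?u = ereal l"
      using fin1 fin2 eq by (cases "limsup ?u") auto
    ultimately have "?u \<longlonglongrightarrow> ereal l"
      by (intro Liminf_eq_Limsup) auto
    then show ?case
      by (auto simp: convergent_def)
  qed
qed

section \<open>Convergence of ergodic averages in L^1\<close>

lemma integral_birkhoff_avg_diff_le:
  assumes "integrable M f" "integrable M h"
  shows "(\<integral>x. \<bar>birkhoff_avg f n x - birkhoff_avg h n x\<bar> \<partial>M) \<le> (\<integral>x. \<bar>f x - h x\<bar> \<partial>M)"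
proof -
  have int: "integrable M (\<lambda>x. \<bar>f x - h x\<bar>)"
    using assms by simp
  have "(\<integral>x. \<bar>birkhoff_avg f n x - birkhoff_avg h n x\<bar> \<partial>M) \<le> (\<integral>x. birkhoff_sum (\<lambda>x. \<bar>f x - h x\<bar>) n x / n \<partial>M)"
  proof (rule integral_mono)
    fix x
    have "\<bar>birkhoff_avg f n x - birkhoff_avg h n x\<bar> = \<bar>\<Sum>i<n. f ((T ^^ i) x) - h ((T ^^ i) x)\<bar> / n"
      by (simp add: birkhoff_avg_def birkhoff_sum_def sum_subtractf flip: diff_divide_distrib)
    also have "\<dots> \<le> (\<Sum>i<n. \<bar>f ((T ^^ i) x) - h ((T ^^ i) x)\<bar>) / n"
      by (intro divide_right_mono sum_abs) simp
    finally show "\<bar>birkhoff_avg f n x - birkhoff_avg h n x\<bar> \<le> birkhoff_sum (\<lambda>x. \<bar>f x - h x\<bar>) n x / n"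
      by (simp add: birkhoff_sum_def)
  qed (use integral_birkhoff_sum(1)[OF int] assms integral_birkhoff_sum(1) in \<open>auto simp: birkhoff_avg_def[abs_def]\<close>)
  \<comment> \<open>Every summand has the integral of the first one, because \<open>T\<close>
    preserves the measure.\<close>
  also have "\<dots> = n * (\<integral>x. \<bar>f x - h x\<bar> \<partial>M) / n"
    using integral_birkhoff_sum(2)[OF int] by simp
  \<comment> \<open>Only an inequality: for n = 0 the left side is 0 by the convention for
    division.\<close>
  also have "\<dots> \<le> (\<integral>x. \<bar>f x - h x\<bar> \<partial>M)"
    by (cases "n = 0") auto
  finally show ?thesis .
qed


text \<open>For bounded functions L^1 convergence follows by dominated convergence. A general f is
  clipped at level K: averaging is an L^1 contraction, so the averages of f and of its truncation
  differ by at most \<open>e K\<close> for every n, and Fatou's lemma passes this bound on to the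
  limits.\<close>

theorem birkhoff:
  fixes f :: "'a \<Rightarrow> real"
  assumes f: "integrable M f"
  defines "g \<equiv> \<lambda>x. lim (\<lambda>n. birkhoff_avg f n x)"
  shows "AE x in M. (\<lambda>n. birkhoff_avg f n x) \<longlonglongrightarrow> g x"
    and "integrable M g"
    and "(\<lambda>n. \<integral>x. \<bar>birkhoff_avg f n x - g x\<bar> \<partial>M) \<longlonglongrightarrow> 0"
proof -
  have f_meas [measurable]: "f \<in> borel_measurable M"
    using f by auto
  have g_meas [measurable]: "g \<in> borel_measurable M"
    unfolding g_def by measurable
  show conv: "AE x in M. (\<lambda>n. birkhoff_avg f n x) \<longlonglongrightarrow> g x"
    using AE_convergent_birkhoff_avg[OF f] by eventually_elim (simp add: g_def convergent_LIMSEQ_iff)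
  define h where "h K x = max (- real K) (min (real K) (f x))" for K x
  have h_meas [measurable]: "h K \<in> borel_measurable M" for K
    unfolding h_def[abs_def] by measurable
  have h_bound: "\<bar>h K x\<bar> \<le> K" for K x
    by (auto simp: h_def)
  have h: "integrable M (h K)" for K
    using h_bound by (intro integrable_const_bound[of _ K]) auto
  define k where "k K x = lim (\<lambda>n. birkhoff_avg (h K) n x)" for K x
  have k_meas [measurable]: "k K \<in> borel_measurable M" for K
    unfolding k_def[abs_def] by measurable
  have k_conv: "AE x in M. (\<lambda>n. birkhoff_avg (h K) n x) \<longlonglongrightarrow> k K x" for K
    using AE_convergent_birkhoff_avg[OF h[of K]] by eventually_elim (simp add: k_def convergent_LIMSEQ_iff)
  have avg_bound: "\<bar>birkhoff_avg (h K) n x\<bar> \<le> K" for K n x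
  proof -
    have "\<bar>birkhoff_sum (h K) n x\<bar> \<le> (\<Sum>i<n. real K)"
      unfolding birkhoff_sum_def by (rule order_trans[OF sum_abs sum_mono]) (rule h_bound)
    then show ?thesis
      by (cases "n = 0") (auto simp: birkhoff_avg_def field_simps)
  qed
  have k_bound: "AE x in M. \<bar>k K x\<bar> \<le> K" for K
    using k_conv[of K]
  proof eventually_elim
    case (elim x)
    then have "(\<lambda>n. \<bar>birkhoff_avg (h K) n x\<bar>) \<longlonglongrightarrow> \<bar>k K x\<bar>"
      by (rule tendsto_rabs)
    then show ?case
      by (rule LIMSEQ_le_const2) (use avg_bound in auto)
  qed
  have k: "integrable M (k K)" for K
    using k_bound[of K] by (intro integrable_const_bound[of _ K]) auto
  have avg_int: "integrable M (birkhoff_avg u n)" if "integrable M u" for u n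
    using integral_birkhoff_sum(1)[OF that] by (simp add: birkhoff_avg_def[abs_def])
  define e where "e K = (\<integral>x. \<bar>f x - h K x\<bar> \<partial>M)" for K
  have e_lim: "e \<longlonglongrightarrow> 0"
  proof -
    have "(\<lambda>K. \<integral>x. \<bar>f x - h K x\<bar> \<partial>M) \<longlonglongrightarrow> (\<integral>x. 0 \<partial>M)"
    proof (rule integral_dominated_convergence[where w="\<lambda>x. \<bar>f x\<bar>"])
      show "AE x in M. (\<lambda>K. \<bar>f x - h K x\<bar>) \<longlonglongrightarrow> 0"
      proof (rule AE_I2, rule tendsto_eventually, rule eventually_sequentiallyI)
        show "\<bar>f x - h K x\<bar> = 0" if "nat \<lceil>\<bar>f x\<bar>\<rceil> \<le> K" for x K
          using that by (auto simp: h_def max_def min_def)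
      qed
      show "AE x in M. norm \<bar>f x - h K x\<bar> \<le> \<bar>f x\<bar>" for K
        by (auto simp: h_def max_def min_def)
    qed (use f in auto)
    then show ?thesis
      by (simp add: e_def[abs_def])
  qed
  have gk: "integrable M (\<lambda>x. g x - k K x)" "(\<integral>x. \<bar>g x - k K x\<bar> \<partial>M) \<le> e K" for K
  proof -
    \<comment> \<open>The estimate is made with extended integrals because \<open>g\<close> is not
      yet known to be integrable; integrability is read off from it.\<close>
    have "(\<integral>\<^sup>+x. \<bar>g x - k K x\<bar> \<partial>M) = (\<integral>\<^sup>+x. liminf (\<lambda>n. ennreal \<bar>birkhoff_avg f n x - birkhoff_avg (h K) n x\<bar>) \<partial>M)"
    proof (rule nn_integral_cong_AE)
      show "AE x in M. ennreal \<bar>g x - k K x\<bar> = liminf (\<lambda>n. ennreal \<bar>birkhoff_avg f n x - birkhoff_avg (h K) n x\<bar>)"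
        using conv k_conv[of K]
        by eventually_elim (intro lim_imp_Liminf[symmetric] tendsto_ennrealI tendsto_rabs tendsto_diff; simp)
    qed
    also have "\<dots> \<le> liminf (\<lambda>n. \<integral>\<^sup>+x. \<bar>birkhoff_avg f n x - birkhoff_avg (h K) n x\<bar> \<partial>M)"
      by (rule nn_integral_liminf) simp
    also have "\<dots> \<le> liminf (\<lambda>n::nat. ennreal (e K))"
    proof (intro Liminf_mono always_eventually allI)
      fix n
      have "(\<integral>\<^sup>+x. \<bar>birkhoff_avg f n x - birkhoff_avg (h K) n x\<bar> \<partial>M) =
          ennreal (\<integral>x. \<bar>birkhoff_avg f n x - birkhoff_avg (h K) n x\<bar> \<partial>M)"
        using avg_int[OF f] avg_int[OF h] by (intro nn_integral_eq_integral) auto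
      also have "\<dots> \<le> ennreal (e K)"
        unfolding e_def by (intro ennreal_leI integral_birkhoff_avg_diff_le f h)
      finally show "(\<integral>\<^sup>+x. \<bar>birkhoff_avg f n x - birkhoff_avg (h K) n x\<bar> \<partial>M) \<le> ennreal (e K)" .
    qed
    also have "\<dots> = ennreal (e K)"
      by (simp add: Liminf_const)
    finally have le: "(\<integral>\<^sup>+x. \<bar>g x - k K x\<bar> \<partial>M) \<le> ennreal (e K)" .
    show int: "integrable M (\<lambda>x. g x - k K x)"
      using le by (intro integrableI_bounded) (auto intro: le_less_trans)
    have "0 \<le> e K"
      by (simp add: e_def)
    then show "(\<integral>x. \<bar>g x - k K x\<bar> \<partial>M) \<le> e K"
      using le int by (subst (asm) nn_integral_eq_integral) auto
  qed
  show g: "integrable M g"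
    using Bochner_Integration.integrable_add[OF gk(1)[of 0] k[of 0]] by simp
  show "(\<lambda>n. \<integral>x. \<bar>birkhoff_avg f n x - g x\<bar> \<partial>M) \<longlonglongrightarrow> 0"
  proof (rule LIMSEQ_I)
    fix r :: real assume "0 < r"
    then obtain K where "norm (e K - 0) < r / 3"
      using LIMSEQ_D[OF e_lim, of "r / 3"] by auto
    then have eK: "e K < r / 3"
      by simp
    have "(\<lambda>n. \<integral>x. \<bar>birkhoff_avg (h K) n x - k K x\<bar> \<partial>M) \<longlonglongrightarrow> (\<integral>x. 0 \<partial>M)"
    proof (rule integral_dominated_convergence[where w="\<lambda>x. 2 * real K"])
      show "AE x in M. (\<lambda>n. \<bar>birkhoff_avg (h K) n x - k K x\<bar>) \<longlonglongrightarrow> 0"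
        using k_conv[of K] by eventually_elim (simp add: LIM_zero tendsto_rabs_zero)
      show "AE x in M. norm \<bar>birkhoff_avg (h K) n x - k K x\<bar> \<le> 2 * real K" for n
        using k_bound[of K]
      proof eventually_elim
        case (elim x)
        then show ?case
          using avg_bound[of K n x] by simp
      qed
    qed auto
    then have "(\<lambda>n. \<integral>x. \<bar>birkhoff_avg (h K) n x - k K x\<bar> \<partial>M) \<longlonglongrightarrow> 0"
      by simp
    from LIMSEQ_D[OF this, of "r / 3"] \<open>0 < r\<close>
    obtain N where N: "\<And>n. N \<le> n \<Longrightarrow> (\<integral>x. \<bar>birkhoff_avg (h K) n x - k K x\<bar> \<partial>M) < r / 3"
      by auto
    have "norm ((\<integral>x. \<bar>birkhoff_avg f n x - g x\<bar> \<partial>M) - 0) < r" if "N \<le> n" for n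
    proof -
      have "(\<integral>x. \<bar>birkhoff_avg f n x - g x\<bar> \<partial>M) \<le>
          (\<integral>x. \<bar>birkhoff_avg f n x - birkhoff_avg (h K) n x\<bar> + \<bar>birkhoff_avg (h K) n x - k K x\<bar> + \<bar>g x - k K x\<bar> \<partial>M)"
        using avg_int[OF f] avg_int[OF h] k g by (intro integral_mono) auto
      also have "\<dots> = (\<integral>x. \<bar>birkhoff_avg f n x - birkhoff_avg (h K) n x\<bar> \<partial>M) +
          (\<integral>x. \<bar>birkhoff_avg (h K) n x - k K x\<bar> \<partial>M) + (\<integral>x. \<bar>g x - k K x\<bar> \<partial>M)"
        using avg_int[OF f] avg_int[OF h] k g by simp
      finally show ?thesis
        using N[OF that] eK gk(2)[of K] integral_birkhoff_avg_diff_le[OF f h[of K], of n]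
        by (simp add: e_def)
    qed
    then show "\<exists>N. \<forall>n\<ge>N. norm ((\<integral>x. \<bar>birkhoff_avg f n x - g x\<bar> \<partial>M) - 0) < r"
      by blast
  qed
qed

end

section \<open>Uniqueness from moments and Laplace transforms\<close>

text \<open>Uniqueness in the Hausdorff moment problem. Equal moments give equal integrals of
  polynomials, by Weierstrass of continuous functions on the unit interval, and by monotone ramps of
  indicators of half-lines.\<close>

lemma borel_measure_eqI_moments:
  fixes M N :: "real measure"
  assumes "finite_measure M" "finite_measure N"
    and sets [measurable_cong]: "sets M = sets borel" "sets N = sets borel"
    and M01: "AE x in M. 0 \<le> x \<and> x \<le> 1" and N01: "AE x in N. 0 \<le> x \<and> x \<le> 1"
    and moments: "\<And>k. (\<integral>\<^sup>+x. ennreal (x ^ k) \<partial>M) = (\<integral>\<^sup>+x. ennreal (x ^ k) \<partial>N)"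
  shows "M = N"
proof -
  interpret M: finite_measure M by fact
  interpret N: finite_measure N by fact
  have int_power: "integrable L (\<lambda>x. x ^ k)"
    if "finite_measure L" "sets L = sets borel" "AE x in L. 0 \<le> x \<and> x \<le> 1" for L :: "real measure" and k
  proof (rule finite_measure.integrable_const_bound[OF that(1)])
    show "AE x in L. norm (x ^ k) \<le> 1"
      using that(3) by eventually_elim (simp add: power_le_one)
  qed (simp add: measurable_cong_sets[OF that(2) refl])
  note int_M = int_power[OF M.finite_measure_axioms sets(1) M01]
  note int_N = int_power[OF N.finite_measure_axioms sets(2) N01]
  have power: "(\<integral>x. x ^ k \<partial>M) = (\<integral>x. x ^ k \<partial>N)" for k
  proof -
    have "(\<integral>x. x ^ k \<partial>M) = enn2real (\<integral>\<^sup>+x. ennreal (x ^ k) \<partial>M)"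
      using M01 by (intro integral_eq_nn_integral) auto
    moreover have "(\<integral>x. x ^ k \<partial>N) = enn2real (\<integral>\<^sup>+x. ennreal (x ^ k) \<partial>N)"
      using N01 by (intro integral_eq_nn_integral) auto
    ultimately show ?thesis
      by (simp add: moments)
  qed
  have cont: "(\<integral>x. f x \<partial>M) = (\<integral>x. f x \<partial>N)"
    if cont: "continuous_on UNIV f" and bounded: "\<And>x. \<bar>f x\<bar> \<le> 1" for f :: "real \<Rightarrow> real"
  proof -
    have [measurable]: "f \<in> borel_measurable borel"
      using cont by (rule borel_measurable_continuous_onI)
    have f: "integrable M f" "integrable N f"
      using bounded by (auto intro!: M.integrable_const_bound[of _ 1] N.integrable_const_bound[of _ 1])
    let ?C = "measure M (space M) + measure N (space N)"
    have le: "\<bar>(\<integral>x. f x \<partial>M) - (\<integral>x. f x \<partial>N)\<bar> \<le> e * ?C" if "0 < e" for e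
    proof -
      obtain g where g: "real_polynomial_function g" "\<And>x. x \<in> {0..1} \<Longrightarrow> \<bar>f x - g x\<bar> < e"
        using Stone_Weierstrass_real_polynomial_function[of "{0..1::real}" f e] \<open>0 < e\<close>
          continuous_on_subset[OF cont] by auto
      then obtain a n where g_eq: "g = (\<lambda>x. \<Sum>i\<le>n. a i * x ^ i)"
        using real_polynomial_function_imp_sum by blast
      have g_int: "integrable M g" "integrable N g"
        unfolding g_eq using int_M int_N by auto
      have g_same: "(\<integral>x. g x \<partial>M) = (\<integral>x. g x \<partial>N)"
        unfolding g_eq using int_M int_N by (simp add: power)
      have approx: "\<bar>(\<integral>x. f x \<partial>L) - (\<integral>x. g x \<partial>L)\<bar> \<le> e * measure L (space L)"
        if L: "finite_measure L" "integrable L f" "integrable L g" "AE x in L. 0 \<le> x \<and> x \<le> 1" for L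
      proof -
        have "\<bar>(\<integral>x. f x \<partial>L) - (\<integral>x. g x \<partial>L)\<bar> = \<bar>\<integral>x. f x - g x \<partial>L\<bar>"
          using L by simp
        also have "\<dots> \<le> (\<integral>x. \<bar>f x - g x\<bar> \<partial>L)"
          by (rule integral_abs_bound)
        also have "\<dots> \<le> (\<integral>x. e \<partial>L)"
        proof (rule integral_mono_AE)
          show "AE x in L. \<bar>f x - g x\<bar> \<le> e"
            using L(4) by eventually_elim (use g(2) in \<open>auto intro: less_imp_le\<close>)
        qed (use L in \<open>auto simp: finite_measure.integrable_const\<close>)
        finally show ?thesis
          by (simp add: mult.commute)
      qed
      show ?thesis
        using approx[OF M.finite_measure_axioms f(1) g_int(1) M01] approx[OF N.finite_measure_axioms f(2) g_int(2) N01] g_same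
        by (simp add: distrib_left)
    qed
    have "\<bar>(\<integral>x. f x \<partial>M) - (\<integral>x. f x \<partial>N)\<bar> \<le> 0"
    proof (rule field_le_epsilon)
      fix e :: real assume "0 < e"
      \<comment> \<open>The added 1 keeps the quotient meaningful when both measures vanish.\<close>
      have "\<bar>(\<integral>x. f x \<partial>M) - (\<integral>x. f x \<partial>N)\<bar> \<le> e / (?C + 1) * ?C"
        using \<open>0 < e\<close> by (intro le divide_pos_pos add_nonneg_pos) auto
      also have "\<dots> \<le> e / (?C + 1) * (?C + 1)"
        using \<open>0 < e\<close> by (intro mult_left_mono) auto
      also have "\<dots> = e"
        by (simp add: add_nonneg_eq_0_iff add_nonneg_pos order_less_imp_not_eq2)
      finally show "\<bar>(\<integral>x. f x \<partial>M) - (\<integral>x. f x \<partial>N)\<bar> \<le> 0 + e"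
        by simp
    qed
    then show ?thesis
      by simp
  qed
  show ?thesis
  proof (rule measure_eqI_lessThan)
    fix a :: real
    \<comment> \<open>A ramp that is 0 up to a and rises with slope n to 1, hence tends to the
      indicator of the open half-line.\<close>
    define u where "u n x = min 1 (max 0 (real n * (x - a)))" for n x
    have u_cont: "continuous_on UNIV (u n)" for n
      unfolding u_def by (intro continuous_intros)
    have u_bound: "\<bar>u n x\<bar> \<le> 1" for n x
      by (simp add: u_def)
    have u_meas [measurable]: "u n \<in> borel_measurable borel" for n
      using u_cont by (rule borel_measurable_continuous_onI)
    have u_lim: "(\<lambda>n. u n x) \<longlonglongrightarrow> indicator {a<..} x" for x
    proof (cases "a < x")
      case True
      then obtain N :: nat where N: "1 < N * (x - a)"
        using reals_Archimedean3[of "x - a"] by auto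
      have "u n x = 1" if "N \<le> n" for n
      proof -
        have "N * (x - a) \<le> n * (x - a)"
          using that True by (intro mult_right_mono) auto
        with N show ?thesis
          by (simp add: u_def)
      qed
      with True show ?thesis
        by (intro tendsto_eventually eventually_sequentiallyI[of N]) simp
    next
      case False
      then have "u n x = 0" for n
        by (simp add: u_def max_absorb1 mult_nonneg_nonpos)
      with False show ?thesis
        by simp
    qed
    have lim: "(\<lambda>n. \<integral>x. u n x \<partial>L) \<longlonglongrightarrow> measure L {a<..}"
      if L: "finite_measure L" "sets L = sets borel" for L
    proof -
      note [measurable_cong] = L(2)
      have "(\<lambda>n. \<integral>x. u n x \<partial>L) \<longlonglongrightarrow> (\<integral>x. indicator {a<..} x \<partial>L)"
        using u_lim u_bound
        by (intro integral_dominated_convergence[where w="\<lambda>_. 1"]) (auto simp: finite_measure.integrable_const[OF L(1)])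
      then show ?thesis
        using L(2) by (simp add: sets_eq_imp_space_eq[OF L(2)])
    qed
    have "measure M {a<..} = measure N {a<..}"
      using LIMSEQ_unique[OF lim[OF M.finite_measure_axioms sets(1)], of "measure N {a<..}"]
        lim[OF N.finite_measure_axioms sets(2)] cont[OF u_cont u_bound] by simp
    then show "emeasure M {a<..} = emeasure N {a<..}"
      by (simp add: M.emeasure_eq_measure N.emeasure_eq_measure)
    show "emeasure M {a<..} < \<infinity>"
      by (simp add: M.emeasure_eq_measure)
  qed (fact sets)+
qed

text \<open>The substitution y = exp (- x) turns Laplace transforms at natural arguments into mixed
  moments on the unit cube, so these arguments suffice. The function \<open>w\<close> interpolates
  between transforms (j = 0) and cylinder sets (j = d): the first j coordinates are tested by
  indicators, the rest by exponentials. Each induction step converts one coordinate through a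
  one-dimensional moment problem.\<close>

lemma PiM_eqI_laplace:
  fixes M N :: "(nat \<Rightarrow> real) measure"
  assumes "finite_measure M" "finite_measure N"
    and sets [measurable_cong]: "sets M = sets (\<Pi>\<^sub>M i\<in>UNIV. borel)" "sets N = sets (\<Pi>\<^sub>M i\<in>UNIV. borel)"
    and M0: "AE x in M. \<forall>i. 0 \<le> x i" and N0: "AE x in N. \<forall>i. 0 \<le> x i"
    and laplace: "\<And>d k. (\<integral>\<^sup>+x. ennreal (exp (- (\<Sum>i<d. real (k i) * x i))) \<partial>M) =
      (\<integral>\<^sup>+x. ennreal (exp (- (\<Sum>i<d. real (k i) * x i))) \<partial>N)"
  shows "M = N"
proof -
  interpret M: finite_measure M by fact
  interpret N: finite_measure N by fact
  define w where "w j d k B x = (\<Prod>i<j. indicator (B i) (x i)) * ennreal (exp (- (\<Sum>i\<in>{j..<d}. real (k i) * x i)))"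
    for j d and k :: "nat \<Rightarrow> nat" and B :: "nat \<Rightarrow> real set" and x :: "nat \<Rightarrow> real"
  have w_meas [measurable]: "w j d k B \<in> borel_measurable (\<Pi>\<^sub>M i\<in>UNIV. borel)" if [measurable]: "\<And>i. B i \<in> sets borel" for j d k B
    unfolding w_def[abs_def] by measurable
  have w_eq: "(\<integral>\<^sup>+x. w j d k B x \<partial>M) = (\<integral>\<^sup>+x. w j d k B x \<partial>N)"
    if B [measurable]: "\<And>i. B i \<in> sets borel" and "j \<le> d" for j d k B
    using \<open>j \<le> d\<close>
  proof (induction j arbitrary: k)
    case 0
    show ?case
      using laplace[of k d] by (simp add: w_def lessThan_atLeast0)
  next
    case (Suc j)
    \<comment> \<open>With \<open>k j\<close> set to 0 the weight no longer involves coordinate j,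
      so the m-th moment of exp (- x j) under this weight is the integral of \<open>w\<close> with
      \<open>k j\<close> set to m. The induction hypothesis is needed for all these \<open>k\<close>
      at once.\<close>
    let ?w = "w j d (k(j := 0)) B"
    let ?L = "\<lambda>L. distr (density L ?w) borel (\<lambda>x. exp (- x j))"
    have split: "{j..<d} = insert j {Suc j..<d}"
      using Suc.prems by auto
    have mom: "(\<integral>\<^sup>+y. ennreal (y ^ m) \<partial>?L L) = (\<integral>\<^sup>+x. w j d (k(j := m)) B x \<partial>L)"
      if [measurable_cong]: "sets L = sets (\<Pi>\<^sub>M i\<in>UNIV. borel)" for L m
    proof -
      have "(\<integral>\<^sup>+y. ennreal (y ^ m) \<partial>?L L) = (\<integral>\<^sup>+x. ?w x * ennreal (exp (- x j) ^ m) \<partial>L)"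
        by (simp add: nn_integral_distr nn_integral_density)
      also have "\<dots> = (\<integral>\<^sup>+x. w j d (k(j := m)) B x \<partial>L)"
      proof (rule nn_integral_cong)
        fix x
        have "exp (- (\<Sum>i\<in>{j..<d}. real ((k(j := 0)) i) * x i)) * exp (- x j) ^ m =
            exp (- (\<Sum>i\<in>{j..<d}. real ((k(j := m)) i) * x i))"
          by (simp add: split exp_diff exp_minus field_simps flip: exp_of_nat_mult)
        then show "?w x * ennreal (exp (- x j) ^ m) = w j d (k(j := m)) B x"
          by (simp add: w_def mult.assoc flip: ennreal_mult'')
      qed
      finally show ?thesis .
    qed
    have fin: "finite_measure (?L L)"
      if L [measurable_cong]: "sets L = sets (\<Pi>\<^sub>M i\<in>UNIV. borel)" and "finite_measure L" "AE x in L. \<forall>i. 0 \<le> x i" for L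
    proof
      have "emeasure (?L L) (space (?L L)) = (\<integral>\<^sup>+y. ennreal (y ^ 0) \<partial>?L L)"
        by simp
      also have "\<dots> = (\<integral>\<^sup>+x. ?w x \<partial>L)"
        using mom[OF L, of 0] by simp
      also have "\<dots> \<le> (\<integral>\<^sup>+x. 1 \<partial>L)"
        using that(3)
      proof (intro nn_integral_mono_AE, eventually_elim)
        case (elim x)
        have "(\<Prod>i<j. indicator (B i) (x i)) * ennreal (exp (- (\<Sum>i\<in>{j..<d}. real ((k(j := 0)) i) * x i))) \<le> 1 * 1"
          using elim by (intro mult_mono prod_le_1) (auto simp: indicator_def intro!: sum_nonneg)
        then show ?case
          by (simp add: w_def)
      qed
      also have "\<dots> < \<infinity>"
        using finite_measure.emeasure_finite[OF that(2)] by (simp add: top.not_eq_extremum)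
      finally show "emeasure (?L L) (space (?L L)) \<noteq> \<infinity>"
        by simp
    qed
    have unit: "AE y in ?L L. 0 \<le> y \<and> y \<le> 1"
      if [measurable_cong]: "sets L = sets (\<Pi>\<^sub>M i\<in>UNIV. borel)" and "AE x in L. \<forall>i. 0 \<le> x i" for L
      using that(2) by (subst AE_distr_iff) (auto simp: AE_density elim!: eventually_mono)
    have eq: "?L M = ?L N"
      by (intro borel_measure_eqI_moments fin unit sets M0 N0 M.finite_measure_axioms N.finite_measure_axioms)
        (use Suc in \<open>auto simp: mom sets\<close>)
    \<comment> \<open>Coordinate j is recovered from exp (- x j) by -ln, which makes its event
      visible to the one-dimensional law.\<close>
    have ind: "(\<integral>\<^sup>+y. indicator {y. - ln y \<in> B j} y \<partial>?L L) = (\<integral>\<^sup>+x. w (Suc j) d k B x \<partial>L)"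
      if [measurable_cong]: "sets L = sets (\<Pi>\<^sub>M i\<in>UNIV. borel)" for L
    proof -
      have [measurable]: "{y. - ln y \<in> B j} \<in> sets borel"
        using measurable_sets[of "\<lambda>y. - ln y" borel borel "B j"] by (simp add: vimage_def)
      have "(\<integral>\<^sup>+y. indicator {y. - ln y \<in> B j} y \<partial>?L L) = (\<integral>\<^sup>+x. ?w x * indicator {y. - ln y \<in> B j} (exp (- x j)) \<partial>L)"
        by (simp add: nn_integral_distr nn_integral_density del: nn_integral_indicator)
      also have "\<dots> = (\<integral>\<^sup>+x. w (Suc j) d k B x \<partial>L)"
        by (intro nn_integral_cong) (simp add: w_def split indicator_def)
      finally show ?thesis .
    qed
    show ?case
      using ind[OF sets(1)] ind[OF sets(2)] eq by simp
  qed
  show ?thesis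
  proof (rule measure_eqI_PiM_infinite[OF sets])
    fix J :: "nat set" and A :: "nat \<Rightarrow> real set"
    assume J: "finite J" and A: "\<And>i. i \<in> J \<Longrightarrow> A i \<in> sets borel"
    obtain d where d: "J \<subseteq> {..<d}"
      using finite_nat_iff_bounded J by blast
    \<comment> \<open>Padding by \<open>UNIV\<close> turns a cylinder over the index set
      \<open>J\<close> into one over an initial segment.\<close>
    define B where "B i = (if i \<in> J then A i else UNIV)" for i
    let ?E = "prod_emb UNIV (\<lambda>_. borel) J (Pi\<^sub>E J A)"
    have w: "indicator ?E x = w d d (\<lambda>_. 0) B x" for x
    proof -
      have "x \<in> ?E \<longleftrightarrow> (\<forall>i<d. x i \<in> B i)"
        using d by (auto simp: prod_emb_def space_PiM PiE_iff B_def)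
      moreover have "(\<Prod>i<d. indicator (B i) (x i)) = (if \<forall>i<d. x i \<in> B i then 1 else 0 :: ennreal)"
        by (auto intro!: prod.neutral simp: indicator_def)
      ultimately show ?thesis
        by (simp add: w_def indicator_def)
    qed
    have E: "?E \<in> sets (\<Pi>\<^sub>M i\<in>UNIV. borel)"
      using J A by (intro sets_PiM_I) auto
    have "(\<integral>\<^sup>+x. indicator ?E x \<partial>M) = (\<integral>\<^sup>+x. indicator ?E x \<partial>N)"
      unfolding w using A by (intro w_eq) (auto simp: B_def)
    then show "emeasure M ?E = emeasure N ?E"
      using E by (simp add: sets)
  qed (use M.finite_measure_axioms in auto)
qed

section \<open>From absolute moments to Laplace transforms\<close>

lemma nn_integral_laplace_kernel:
  assumes "0 < x" "0 \<le> s"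
  shows "(\<integral>\<^sup>+a. ennreal (max 0 (a * x - s)) * (ennreal (exp (- a)) * indicator {0..} a) \<partial>lborel) = ennreal (x * exp (- (s / x)))"
proof -
  let ?y = "s / x"
  have "0 \<le> ?y"
    using assms by simp
  \<comment> \<open>An antiderivative of (a - y) exp (- a) that vanishes at infinity; its value at y
    is - exp (- y), so the integral from y on is exp (- y).\<close>
  define F where "F a = - (a - ?y + 1) * exp (- a)" for a
  have "((\<lambda>a::real. (?y - 1) * exp (- a) - a / exp a) \<longlongrightarrow> (?y - 1) * 0 - 0) at_top"
    by (intro tendsto_intros filterlim_compose[OF exp_at_bot] filterlim_uminus_at_bot_at_top
        tendsto_power_div_exp_0[of 1, simplified])
  moreover have "F = (\<lambda>a. (?y - 1) * exp (- a) - a / exp a)"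
    by (simp add: fun_eq_iff F_def algebra_simps exp_minus divide_inverse)
  ultimately have F_lim: "(F \<longlongrightarrow> 0) at_top"
    by simp
  have "(\<integral>\<^sup>+a. ennreal (max 0 (a * x - s)) * (ennreal (exp (- a)) * indicator {0..} a) \<partial>lborel) =
      (\<integral>\<^sup>+a. ennreal x * (ennreal (max 0 (a - ?y) * exp (- a)) * indicator {?y..} a) \<partial>lborel)"
  proof (rule nn_integral_cong)
    fix a
    show "ennreal (max 0 (a * x - s)) * (ennreal (exp (- a)) * indicator {0..} a) =
        ennreal x * (ennreal (max 0 (a - ?y) * exp (- a)) * indicator {?y..} a)"
    proof (cases "?y \<le> a")
      case True
      have "x * ?y = s"
        using assms by simp
      then have "max 0 (a * x - s) = x * max 0 (a - ?y)"
        using assms True by (simp add: max_absorb2 right_diff_distrib pos_divide_le_eq mult.commute)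
      moreover have "0 \<le> a"
        using True \<open>0 \<le> ?y\<close> by linarith
      ultimately show ?thesis
        using True assms by (simp add: ennreal_mult' mult.assoc)
    next
      case False
      then have "a * x - s < 0"
        using assms by (simp add: field_simps)
      then show ?thesis
        using False by simp
    qed
  qed
  also have "\<dots> = ennreal x * (\<integral>\<^sup>+a. ennreal (max 0 (a - ?y) * exp (- a)) * indicator {?y..} a \<partial>lborel)"
    by (rule nn_integral_cmult) simp
  also have "(\<integral>\<^sup>+a. ennreal (max 0 (a - ?y) * exp (- a)) * indicator {?y..} a \<partial>lborel) = ennreal (0 - F ?y)"
  proof (rule nn_integral_FTC_atLeast)
    show "DERIV F a :> max 0 (a - ?y) * exp (- a)" if "?y \<le> a" for a
      unfolding F_def using that assms by (auto intro!: derivative_eq_intros simp: algebra_simps)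
  qed (use F_lim in auto)
  finally show ?thesis
    using assms by (simp add: F_def ennreal_mult')
qed

text \<open>By Tonelli, \<open>x * exp (- s / x)\<close> is a mixture of the functions \<open>max 0 (a * x - s)\<close>,
  and \<open>max 0 t = (\<bar>t\<bar> + t) / 2\<close>.\<close>

lemma (in sigma_finite_measure) laplace_transform_cong:
  fixes x s s' :: "'a \<Rightarrow> real"
  assumes x: "integrable M x" "AE \<omega> in M. 0 < x \<omega>"
    and s: "integrable M s" "AE \<omega> in M. 0 \<le> s \<omega>" and s': "integrable M s'" "AE \<omega> in M. 0 \<le> s' \<omega>"
    and eq: "\<And>a. 0 \<le> a \<Longrightarrow> (\<integral>\<omega>. \<bar>a * x \<omega> - s \<omega>\<bar> \<partial>M) = (\<integral>\<omega>. \<bar>a * x \<omega> - s' \<omega>\<bar> \<partial>M)"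
  shows "(\<integral>\<^sup>+\<omega>. ennreal (x \<omega> * exp (- (s \<omega> / x \<omega>))) \<partial>M) = (\<integral>\<^sup>+\<omega>. ennreal (x \<omega> * exp (- (s' \<omega> / x \<omega>))) \<partial>M)"
proof -
  interpret P: pair_sigma_finite lborel M ..
  \<comment> \<open>The term with \<open>0 * x \<omega>\<close> is the expectation of the
    nonnegative \<open>t\<close>. Written this way, the right side depends on \<open>t\<close> only
    through integrals that \<open>eq\<close> compares, and the indicator restricts a to the range of
    \<open>eq\<close>.\<close>
  have mixture: "(\<integral>\<^sup>+\<omega>. ennreal (x \<omega> * exp (- (t \<omega> / x \<omega>))) \<partial>M) =
      (\<integral>\<^sup>+a. ennreal (((\<integral>\<omega>. \<bar>a * x \<omega> - t \<omega>\<bar> \<partial>M) + a * (\<integral>\<omega>. x \<omega> \<partial>M) - (\<integral>\<omega>. \<bar>0 * x \<omega> - t \<omega>\<bar> \<partial>M)) / 2)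
        * (ennreal (exp (- a)) * indicator {0..} a) \<partial>lborel)"
    if t: "integrable M t" "AE \<omega> in M. 0 \<le> t \<omega>" for t
  proof -
    have [measurable]: "x \<in> borel_measurable M" "t \<in> borel_measurable M"
      using x t by auto
    have "(\<integral>\<^sup>+\<omega>. ennreal (x \<omega> * exp (- (t \<omega> / x \<omega>))) \<partial>M) =
        (\<integral>\<^sup>+\<omega>. (\<integral>\<^sup>+a. ennreal (max 0 (a * x \<omega> - t \<omega>)) * (ennreal (exp (- a)) * indicator {0..} a) \<partial>lborel) \<partial>M)"
      using x(2) t(2) by (intro nn_integral_cong_AE, eventually_elim) (rule nn_integral_laplace_kernel[symmetric])
    also have "\<dots> = (\<integral>\<^sup>+a. (\<integral>\<^sup>+\<omega>. ennreal (max 0 (a * x \<omega> - t \<omega>)) * (ennreal (exp (- a)) * indicator {0..} a) \<partial>M) \<partial>lborel)"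
      by (rule P.Fubini') measurable
    also have "\<dots> = (\<integral>\<^sup>+a. (\<integral>\<^sup>+\<omega>. ennreal (max 0 (a * x \<omega> - t \<omega>)) \<partial>M) * (ennreal (exp (- a)) * indicator {0..} a) \<partial>lborel)"
      by (intro nn_integral_cong nn_integral_multc) simp
    also have "\<dots> = (\<integral>\<^sup>+a. ennreal (((\<integral>\<omega>. \<bar>a * x \<omega> - t \<omega>\<bar> \<partial>M) + a * (\<integral>\<omega>. x \<omega> \<partial>M) - (\<integral>\<omega>. \<bar>0 * x \<omega> - t \<omega>\<bar> \<partial>M)) / 2)
        * (ennreal (exp (- a)) * indicator {0..} a) \<partial>lborel)"
    proof (intro nn_integral_cong arg_cong2[where f="(*)"] refl)
      fix a
      have "(\<integral>\<^sup>+\<omega>. ennreal (max 0 (a * x \<omega> - t \<omega>)) \<partial>M) = ennreal (\<integral>\<omega>. max 0 (a * x \<omega> - t \<omega>) \<partial>M)"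
        using x t by (intro nn_integral_eq_integral) auto
      also have "(\<integral>\<omega>. max 0 (a * x \<omega> - t \<omega>) \<partial>M) = (\<integral>\<omega>. (\<bar>a * x \<omega> - t \<omega>\<bar> + (a * x \<omega> - t \<omega>)) / 2 \<partial>M)"
        by (intro Bochner_Integration.integral_cong) (auto simp: max_def)
      also have "\<dots> = ((\<integral>\<omega>. \<bar>a * x \<omega> - t \<omega>\<bar> \<partial>M) + a * (\<integral>\<omega>. x \<omega> \<partial>M) - (\<integral>\<omega>. t \<omega> \<partial>M)) / 2"
        using x t by simp
      also have "(\<integral>\<omega>. t \<omega> \<partial>M) = (\<integral>\<omega>. \<bar>0 * x \<omega> - t \<omega>\<bar> \<partial>M)"
        using t by (intro integral_cong_AE) (auto elim!: eventually_mono)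
      finally show "(\<integral>\<^sup>+\<omega>. ennreal (max 0 (a * x \<omega> - t \<omega>)) \<partial>M) =
          ennreal (((\<integral>\<omega>. \<bar>a * x \<omega> - t \<omega>\<bar> \<partial>M) + a * (\<integral>\<omega>. x \<omega> \<partial>M) - (\<integral>\<omega>. \<bar>0 * x \<omega> - t \<omega>\<bar> \<partial>M)) / 2)" .
    qed
    finally show ?thesis .
  qed
  show ?thesis
    unfolding mixture[OF s] mixture[OF s']
  proof (rule nn_integral_cong)
    fix a :: real
    show "ennreal (((\<integral>\<omega>. \<bar>a * x \<omega> - s \<omega>\<bar> \<partial>M) + a * (\<integral>\<omega>. x \<omega> \<partial>M) - (\<integral>\<omega>. \<bar>0 * x \<omega> - s \<omega>\<bar> \<partial>M)) / 2)
        * (ennreal (exp (- a)) * indicator {0..} a) =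
      ennreal (((\<integral>\<omega>. \<bar>a * x \<omega> - s' \<omega>\<bar> \<partial>M) + a * (\<integral>\<omega>. x \<omega> \<partial>M) - (\<integral>\<omega>. \<bar>0 * x \<omega> - s' \<omega>\<bar> \<partial>M)) / 2)
        * (ennreal (exp (- a)) * indicator {0..} a)"
      using eq[of a] eq[of 0] by (cases "0 \<le> a") auto
  qed
qed

section \<open>The law of the ratios under the weighted measure\<close>

lemma swap_invariant_seq_permute:
  assumes "swap_invariant_seq M \<xi>" "\<pi> permutes {..<d}"
  shows "(\<integral>\<omega>. \<bar>\<Sum>i<d. u i * \<xi> (\<pi> i) \<omega>\<bar> \<partial>M) = (\<integral>\<omega>. \<bar>\<Sum>i<d. u i * \<xi> i \<omega>\<bar> \<partial>M)"
proof -
  have "strict_mono_on {..<d} (\<lambda>i::nat. i)"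
    by (simp add: strict_mono_on_def)
  then have "swap_invariant_vec M d \<xi>"
    using assms(1) by (auto simp: swap_invariant_seq_def)
  then have "zonoid_equivalent d M (\<lambda>i. \<xi> (\<pi> i)) M (\<lambda>i. \<xi> (id i))"
    using assms(2) permutes_id unfolding swap_invariant_vec_def by blast
  then show ?thesis
    by (simp add: zonoid_equivalent_def)
qed

definition seq_mean :: "(nat \<Rightarrow> real) \<Rightarrow> real" where
  "seq_mean x = lim (\<lambda>n. (\<Sum>i<n. x i) / n)"

lemma seq_mean_measurable [measurable]: "seq_mean \<in> borel_measurable (\<Pi>\<^sub>M i\<in>UNIV. borel)"
  unfolding seq_mean_def[abs_def] by measurable

text \<open>Once n passes the support of the permutation, the first n terms are only reordered.
  Since \<open>lim\<close> depends only on which limits exist, equality holds even where the means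
  diverge; \<open>perm_invariant_sets\<close> asks for invariance at every sequence.\<close>

lemma seq_mean_permute:
  assumes "finite S" "\<pi> permutes S"
  shows "seq_mean (\<lambda>i. x (\<pi> i)) = seq_mean x"
proof -
  obtain N where N: "S \<subseteq> {..<N}"
    using finite_nat_iff_bounded assms(1) by blast
  have "(\<Sum>i<n. x (\<pi> i)) / n = (\<Sum>i<n. x i) / n" if "N \<le> n" for n
  proof -
    have "\<pi> permutes {..<n}"
      using assms(2) N that by (intro permutes_subset[OF assms(2)]) auto
    from sum.permute[OF this, of x] show ?thesis
      by (simp add: comp_def)
  qed
  then have "\<forall>\<^sub>F n in sequentially. (\<Sum>i<n. x (\<pi> i)) / n = (\<Sum>i<n. x i) / n"
    by (rule eventually_sequentiallyI)
  then have "(\<lambda>n. (\<Sum>i<n. x (\<pi> i)) / n) \<longlonglongrightarrow> l \<longleftrightarrow> (\<lambda>n. (\<Sum>i<n. x i) / n) \<longlonglongrightarrow> l" for l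
    by (rule tendsto_cong)
  then show ?thesis
    by (simp add: seq_mean_def lim_def)
qed

locale positive_swap_invariant = prob_space M for M :: "'a measure" +
  fixes \<xi> :: "nat \<Rightarrow> 'a \<Rightarrow> real"
  assumes swap_invariant: "swap_invariant_seq M \<xi>"
    and pos: "\<And>i. AE \<omega> in M. 0 < \<xi> i \<omega>"
begin

lemma integrable_\<xi>: "integrable M (\<xi> i)"
  using swap_invariant by (simp add: swap_invariant_seq_def)

lemma measurable_\<xi> [measurable]: "\<xi> i \<in> borel_measurable M"
  using integrable_\<xi> by auto

lemma AE_pos: "AE \<omega> in M. \<forall>i. 0 < \<xi> i \<omega>"
  using pos by (simp add: AE_all_countable)

definition ratio :: "nat \<Rightarrow> 'a \<Rightarrow> real" where
  "ratio i \<omega> = \<xi> (Suc i) \<omega> / \<xi> 0 \<omega>"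

lemma measurable_ratio [measurable]: "ratio i \<in> borel_measurable M"
  unfolding ratio_def[abs_def] by measurable

lemma measurable_ratio_seq [measurable]: "(\<lambda>\<omega> i. ratio i \<omega>) \<in> M \<rightarrow>\<^sub>M (\<Pi>\<^sub>M i\<in>UNIV. borel)"
  by (rule measurable_PiM_single') auto

definition tilted_law :: "(nat \<Rightarrow> real) measure" where
  "tilted_law = distr (density M (\<lambda>\<omega>. ennreal (\<xi> 0 \<omega>))) (\<Pi>\<^sub>M i\<in>UNIV. borel) (\<lambda>\<omega> i. ratio i \<omega>)"

lemma sets_tilted_law [simp, measurable_cong]: "sets tilted_law = sets (\<Pi>\<^sub>M i\<in>UNIV. borel)"
  by (simp add: tilted_law_def)

lemma space_tilted_law [simp]: "space tilted_law = UNIV"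
  by (simp add: tilted_law_def space_PiM)

lemma nn_integral_tilted_law:
  assumes [measurable]: "g \<in> borel_measurable (\<Pi>\<^sub>M i\<in>UNIV. borel)"
  shows "(\<integral>\<^sup>+x. g x \<partial>tilted_law) = (\<integral>\<^sup>+\<omega>. ennreal (\<xi> 0 \<omega>) * g (\<lambda>i. ratio i \<omega>) \<partial>M)"
  unfolding tilted_law_def by (simp add: nn_integral_distr nn_integral_density)

lemma
  fixes g :: "(nat \<Rightarrow> real) \<Rightarrow> real"
  assumes [measurable]: "g \<in> borel_measurable (\<Pi>\<^sub>M i\<in>UNIV. borel)"
  shows integrable_tilted_law: "integrable tilted_law g \<longleftrightarrow> integrable M (\<lambda>\<omega>. \<xi> 0 \<omega> * g (\<lambda>i. ratio i \<omega>))"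
    and integral_tilted_law: "(\<integral>x. g x \<partial>tilted_law) = (\<integral>\<omega>. \<xi> 0 \<omega> * g (\<lambda>i. ratio i \<omega>) \<partial>M)"
proof -
  have nonneg: "AE \<omega> in M. 0 \<le> \<xi> 0 \<omega>"
    using pos[of 0] by eventually_elim simp
  show "integrable tilted_law g \<longleftrightarrow> integrable M (\<lambda>\<omega>. \<xi> 0 \<omega> * g (\<lambda>i. ratio i \<omega>))"
    using nonneg unfolding tilted_law_def by (simp add: integrable_distr_eq integrable_density)
  show "(\<integral>x. g x \<partial>tilted_law) = (\<integral>\<omega>. \<xi> 0 \<omega> * g (\<lambda>i. ratio i \<omega>) \<partial>M)"
    using nonneg unfolding tilted_law_def by (simp add: integral_distr integral_density)
qed

text \<open>The density \<open>\<xi> 0\<close> is almost surely positive, so weighting creates no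
  new null events.\<close>

lemma AE_tilted_law_iff:
  assumes [measurable]: "Measurable.pred (\<Pi>\<^sub>M i\<in>UNIV. borel) P"
  shows "(AE x in tilted_law. P x) \<longleftrightarrow> (AE \<omega> in M. P (\<lambda>i. ratio i \<omega>))"
proof -
  have "{x. P x} \<in> sets (\<Pi>\<^sub>M i\<in>UNIV. borel)"
    using assms by (simp add: pred_def space_PiM)
  then have "(AE x in tilted_law. P x) \<longleftrightarrow> (AE \<omega> in M. 0 < \<xi> 0 \<omega> \<longrightarrow> P (\<lambda>i. ratio i \<omega>))"
    unfolding tilted_law_def by (subst AE_distr_iff) (auto simp: AE_density space_PiM)
  also have "\<dots> \<longleftrightarrow> (AE \<omega> in M. P (\<lambda>i. ratio i \<omega>))"
    using pos[of 0] by (intro eventually_subst) (auto elim!: eventually_mono)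
  finally show ?thesis .
qed

lemma finite_tilted_law: "finite_measure tilted_law"
proof
  have "emeasure tilted_law (space tilted_law) = (\<integral>\<^sup>+x. 1 \<partial>tilted_law)"
    by simp
  also have "\<dots> = (\<integral>\<^sup>+\<omega>. ennreal (\<xi> 0 \<omega>) \<partial>M)"
    by (subst nn_integral_tilted_law) auto
  also have "\<dots> = ennreal (\<integral>\<omega>. \<xi> 0 \<omega> \<partial>M)"
    using pos[of 0] by (intro nn_integral_eq_integral integrable_\<xi>) (auto elim!: eventually_mono)
  finally show "emeasure tilted_law (space tilted_law) \<noteq> \<infinity>"
    by simp
qed

lemma AE_tilted_law_nonneg: "AE x in tilted_law. \<forall>i. 0 \<le> x i"
  using AE_pos by (subst AE_tilted_law_iff) (auto elim!: eventually_mono simp: ratio_def less_imp_le)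

text \<open>The hypothesis admits the shift, which is injective but not a permutation.\<close>

lemma tilted_law_reindex:
  assumes \<rho>: "\<And>d. \<exists>N \<pi>. d \<le> N \<and> \<pi> permutes {..<N} \<and> (\<forall>i<d. \<pi> i = \<rho> i)"
  shows "distr tilted_law tilted_law (\<lambda>x i. x (\<rho> i)) = tilted_law"
proof -
  interpret T: finite_measure tilted_law
    by (rule finite_tilted_law)
  have meas [measurable]: "(\<lambda>x i. x (\<rho> i)) \<in> tilted_law \<rightarrow>\<^sub>M tilted_law"
    by (subst measurable_cong_sets[OF sets_tilted_law sets_tilted_law], rule measurable_PiM_single') auto
  show ?thesis
  proof (rule PiM_eqI_laplace)
    show "finite_measure (distr tilted_law tilted_law (\<lambda>x i. x (\<rho> i)))"
      by (rule T.finite_measure_distr) simp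
    have "Measurable.pred (\<Pi>\<^sub>M i\<in>UNIV. borel) (\<lambda>x::nat \<Rightarrow> real. \<forall>i. 0 \<le> x i)"
      by measurable
    then show "AE x in distr tilted_law tilted_law (\<lambda>x i. x (\<rho> i)). \<forall>i. 0 \<le> x i"
      using AE_tilted_law_nonneg by (subst AE_distr_iff) (auto elim!: eventually_mono simp: pred_def space_PiM)
    fix d and k :: "nat \<Rightarrow> nat"
    \<comment> \<open>Divided by \<open>\<xi> 0\<close>, this is the Laplace exponent of the ratios
      reindexed by \<sigma>, so the weighted transform takes the form handled by
      \<open>laplace_transform_cong\<close>.\<close>
    define s where "s \<sigma> \<omega> = (\<Sum>i<d. real (k i) * \<xi> (Suc (\<sigma> i)) \<omega>)" for \<sigma> \<omega>
    have s: "integrable M (s \<sigma>)" "AE \<omega> in M. 0 \<le> s \<sigma> \<omega>" for \<sigma>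
    proof -
      show "integrable M (s \<sigma>)"
        unfolding s_def[abs_def] by (intro Bochner_Integration.integrable_sum integrable_mult_right integrable_\<xi>)
      show "AE \<omega> in M. 0 \<le> s \<sigma> \<omega>"
        using AE_pos
      proof eventually_elim
        case (elim \<omega>)
        then show ?case
          unfolding s_def by (intro sum_nonneg mult_nonneg_nonneg less_imp_le[of 0 "\<xi> _ \<omega>"]) auto
      qed
    qed
    obtain N \<pi> where \<pi>: "d \<le> N" "\<pi> permutes {..<N}" "\<And>i. i < d \<Longrightarrow> \<pi> i = \<rho> i"
      using \<rho> by blast
    \<comment> \<open>The permutation of the ratios lifted to \<xi>: shifted by one, with the
      denominator fixed.\<close>
    define \<pi>' where "\<pi>' i = (case i of 0 \<Rightarrow> 0 | Suc j \<Rightarrow> Suc (\<pi> j))" for i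
    have \<pi>': "\<pi>' permutes {..<Suc N}"
    proof (rule inj_imp_permutes)
      show "inj_on \<pi>' {..<Suc N}"
        using permutes_inj[OF \<pi>(2)] by (auto simp: inj_on_def \<pi>'_def inj_def split: nat.splits)
      show "\<pi>' i \<in> {..<Suc N}" if "i \<in> {..<Suc N}" for i
        using permutes_in_image[OF \<pi>(2)] that by (auto simp: \<pi>'_def split: nat.splits)
      show "\<pi>' i = i" if "i \<notin> {..<Suc N}" for i
        using permutes_not_in[OF \<pi>(2)] that by (auto simp: \<pi>'_def split: nat.splits)
    qed simp
    have zonoid: "(\<integral>\<omega>. \<bar>a * \<xi> 0 \<omega> - s \<rho> \<omega>\<bar> \<partial>M) = (\<integral>\<omega>. \<bar>a * \<xi> 0 \<omega> - s id \<omega>\<bar> \<partial>M)" for a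
    proof -
      \<comment> \<open>Zero coefficients fill the places from d to N, since agreement with \<rho>
        on d coordinates may need a permutation of more.\<close>
      define u where "u i = (case i of 0 \<Rightarrow> a | Suc j \<Rightarrow> if j < d then - real (k j) else 0)" for i
      have u: "(\<Sum>i<Suc N. u i * \<xi> (\<tau> i) \<omega>) = a * \<xi> 0 \<omega> - s \<sigma> \<omega>"
        if "\<tau> 0 = 0" "\<And>i. i < d \<Longrightarrow> \<tau> (Suc i) = Suc (\<sigma> i)" for \<tau> \<sigma> \<omega>
      proof -
        have "(\<Sum>i<Suc N. u i * \<xi> (\<tau> i) \<omega>) = a * \<xi> 0 \<omega> + (\<Sum>i<N. u (Suc i) * \<xi> (\<tau> (Suc i)) \<omega>)"
          using that by (simp add: sum.lessThan_Suc_shift u_def del: sum.lessThan_Suc)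
        also have "(\<Sum>i<N. u (Suc i) * \<xi> (\<tau> (Suc i)) \<omega>) = (\<Sum>i<d. u (Suc i) * \<xi> (\<tau> (Suc i)) \<omega>)"
          using \<pi>(1) by (intro sum.mono_neutral_right) (auto simp: u_def)
        also have "\<dots> = - s \<sigma> \<omega>"
          using that by (simp add: u_def s_def sum_negf)
        finally show ?thesis
          by simp
      qed
      show ?thesis
        using swap_invariant_seq_permute[OF swap_invariant \<pi>', of u] u[of \<pi>' \<rho>] u[of "\<lambda>i. i" id] \<pi>(3)
        by (simp add: \<pi>'_def)
    qed
    have "(\<integral>\<^sup>+x. ennreal (exp (- (\<Sum>i<d. real (k i) * x i))) \<partial>distr tilted_law tilted_law (\<lambda>x i. x (\<rho> i))) =
        (\<integral>\<^sup>+x. ennreal (exp (- (\<Sum>i<d. real (k i) * x (\<rho> i)))) \<partial>tilted_law)"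
      by (subst nn_integral_distr) auto
    also have "\<dots> = (\<integral>\<^sup>+\<omega>. ennreal (\<xi> 0 \<omega> * exp (- (s \<rho> \<omega> / \<xi> 0 \<omega>))) \<partial>M)"
      by (subst nn_integral_tilted_law)
        (auto simp: s_def ratio_def sum_divide_distrib ennreal_mult'' intro!: nn_integral_cong)
    also have "\<dots> = (\<integral>\<^sup>+\<omega>. ennreal (\<xi> 0 \<omega> * exp (- (s id \<omega> / \<xi> 0 \<omega>))) \<partial>M)"
      by (rule laplace_transform_cong[OF integrable_\<xi> pos s s zonoid])
    also have "\<dots> = (\<integral>\<^sup>+x. ennreal (exp (- (\<Sum>i<d. real (k i) * x i))) \<partial>tilted_law)"
      by (subst nn_integral_tilted_law)
        (auto simp: s_def ratio_def sum_divide_distrib ennreal_mult'' intro!: nn_integral_cong)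
    finally show "(\<integral>\<^sup>+x. ennreal (exp (- (\<Sum>i<d. real (k i) * x i))) \<partial>distr tilted_law tilted_law (\<lambda>x i. x (\<rho> i))) =
        (\<integral>\<^sup>+x. ennreal (exp (- (\<Sum>i<d. real (k i) * x i))) \<partial>tilted_law)" .
  qed (use finite_tilted_law AE_tilted_law_nonneg in auto)
qed

lemma tilted_law_permute:
  assumes "finite S" "\<pi> permutes S"
  shows "distr tilted_law tilted_law (\<lambda>x i. x (\<pi> i)) = tilted_law"
proof (rule tilted_law_reindex)
  fix d
  obtain N where "S \<subseteq> {..<N}"
    using finite_nat_iff_bounded assms(1) by blast
  then have "\<pi> permutes {..<max d N}"
    using assms(2) by (intro permutes_subset[OF assms(2)]) auto
  then show "\<exists>N \<pi>'. d \<le> N \<and> \<pi>' permutes {..<N} \<and> (\<forall>i<d. \<pi>' i = \<pi> i)"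
    by (intro exI[of _ "max d N"] exI[of _ \<pi>]) auto
qed

lemma measure_preserving_shift: "measure_preserving_map tilted_law (\<lambda>x i. x (Suc i))"
proof -
  interpret finite_measure tilted_law
    by (rule finite_tilted_law)
  show ?thesis
  proof
    show "(\<lambda>x i. x (Suc i)) \<in> tilted_law \<rightarrow>\<^sub>M tilted_law"
      by (subst measurable_cong_sets[OF sets_tilted_law sets_tilted_law], rule measurable_PiM_single') auto
    show "distr tilted_law tilted_law (\<lambda>x i. x (Suc i)) = tilted_law"
    proof (rule tilted_law_reindex)
      fix d
      \<comment> \<open>A cycle on d + 1 indices: it agrees with the shift on the first d and sends
        the last one back to 0.\<close>
      let ?\<pi> = "\<lambda>i. if i < d then Suc i else if i = d then 0 else i"
      have "?\<pi> permutes {..<Suc d}"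
        by (rule inj_imp_permutes) (auto simp: inj_on_def)
      then show "\<exists>N \<pi>. d \<le> N \<and> \<pi> permutes {..<N} \<and> (\<forall>i<d. \<pi> i = Suc i)"
        by (intro exI[of _ "Suc d"] exI[of _ ?\<pi>]) auto
    qed
  qed
qed


section \<open>Law of large numbers for the ratios\<close>

lemma \<xi>_0_ratio: "AE \<omega> in M. \<xi> 0 \<omega> * ratio i \<omega> = \<xi> (Suc i) \<omega>"
  using pos[of 0] by eventually_elim (simp add: ratio_def)

lemma integrable_coordinate: "integrable tilted_law (\<lambda>x. x i)"
proof (subst integrable_tilted_law)
  show "integrable M (\<lambda>\<omega>. \<xi> 0 \<omega> * ratio i \<omega>)"
    using \<xi>_0_ratio by (subst integrable_cong_AE[where g="\<xi> (Suc i)"]) (auto intro: integrable_\<xi>)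
qed simp

text \<open>Ergodic averages of coordinate 0 under the shift are the arithmetic means of the
  coordinates.\<close>

lemma tilted_law_lln:
  shows "AE x in tilted_law. (\<lambda>n. (\<Sum>i<n. x i) / n) \<longlonglongrightarrow> seq_mean x"
    and "integrable tilted_law seq_mean"
    and "(\<lambda>n. \<integral>x. \<bar>(\<Sum>i<n. x i) / n - seq_mean x\<bar> \<partial>tilted_law) \<longlonglongrightarrow> 0"
proof -
  interpret measure_preserving_map tilted_law "\<lambda>x i. x (Suc i)"
    by (rule measure_preserving_shift)
  have shift: "((\<lambda>x i. x (Suc i)) ^^ n) x = (\<lambda>i. x (n + i))" for n and x :: "nat \<Rightarrow> real"
    by (induction n) auto
  have avg: "birkhoff_avg (\<lambda>x. x 0) n x = (\<Sum>i<n. x i) / n" for n x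
    by (simp add: birkhoff_avg_def birkhoff_sum_def shift)
  show "AE x in tilted_law. (\<lambda>n. (\<Sum>i<n. x i) / n) \<longlonglongrightarrow> seq_mean x"
    "integrable tilted_law seq_mean"
    "(\<lambda>n. \<integral>x. \<bar>(\<Sum>i<n. x i) / n - seq_mean x\<bar> \<partial>tilted_law) \<longlonglongrightarrow> 0"
    using birkhoff[OF integrable_coordinate[of 0]]
    by (simp_all add: avg seq_mean_def[abs_def])
qed

text \<open>Identifies \<open>seq_mean\<close> as the weighted conditional expectation of the first
  ratio without analysing shift-invariant events. The transposition of 0 and i preserves both the
  law and \<open>B\<close>, so all coordinates, and hence all nonempty means, have the same integral
  over \<open>B\<close>; L^1 convergence carries this to the limit.\<close>

lemma integral_tilted_law_seq_mean:
  assumes B: "B \<in> perm_invariant_sets"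
  shows "(\<integral>x. indicator B x * seq_mean x \<partial>tilted_law) = (\<integral>x. indicator B x * x 0 \<partial>tilted_law)"
proof -
  have [measurable]: "B \<in> sets (\<Pi>\<^sub>M i\<in>UNIV. borel)"
    using B by (simp add: perm_invariant_sets_def)
  have int: "integrable tilted_law (\<lambda>x. indicator B x * x i)" for i
    by (intro integrable_indicator_mult integrable_coordinate) simp
  have coord: "(\<integral>x. indicator B x * x i \<partial>tilted_law) = (\<integral>x. indicator B x * x 0 \<partial>tilted_law)" for i
  proof -
    let ?\<tau> = "Transposition.transpose 0 i"
    have \<tau>: "?\<tau> permutes {0, i}"
      by (rule permutes_swap_id) auto
    have inv: "indicator B (\<lambda>j. x (?\<tau> j)) = (indicator B x :: real)" for x
    proof -
      have "(\<lambda>j. x (?\<tau> j)) \<in> B \<longleftrightarrow> x \<in> B"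
        using B[unfolded perm_invariant_sets_def, THEN CollectD, THEN conjunct2, rule_format, OF _ \<tau>] by simp
      then show ?thesis
        by (simp add: indicator_def)
    qed
    have [measurable]: "(\<lambda>x j. x (?\<tau> j)) \<in> tilted_law \<rightarrow>\<^sub>M tilted_law"
      by (subst measurable_cong_sets[OF sets_tilted_law sets_tilted_law], rule measurable_PiM_single') auto
    have "(\<integral>x. indicator B x * x 0 \<partial>distr tilted_law tilted_law (\<lambda>x j. x (?\<tau> j))) = (\<integral>x. indicator B x * x i \<partial>tilted_law)"
      by (subst integral_distr) (auto simp: inv)
    then show ?thesis
      using tilted_law_permute[OF _ \<tau>] by simp
  qed
  have "(\<lambda>n. \<integral>x. indicator B x * ((\<Sum>i<n. x i) / n) \<partial>tilted_law) \<longlonglongrightarrow> (\<integral>x. indicator B x * seq_mean x \<partial>tilted_law)"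
  proof (rule LIM_zero_cancel, rule tendsto_rabs_zero_cancel, rule tendsto_sandwich[OF _ _ tendsto_const tilted_law_lln(3)])
    show "\<forall>\<^sub>F n in sequentially. \<bar>(\<integral>x. indicator B x * ((\<Sum>i<n. x i) / n) \<partial>tilted_law) - (\<integral>x. indicator B x * seq_mean x \<partial>tilted_law)\<bar>
      \<le> (\<integral>x. \<bar>(\<Sum>i<n. x i) / n - seq_mean x\<bar> \<partial>tilted_law)"
    proof (rule always_eventually, rule allI)
      fix n
      have avg: "integrable tilted_law (\<lambda>x. (\<Sum>i<n. x i) / n)"
        by (intro integrable_divide_zero Bochner_Integration.integrable_sum integrable_coordinate)
      have "(\<integral>x. indicator B x * ((\<Sum>i<n. x i) / n) \<partial>tilted_law) - (\<integral>x. indicator B x * seq_mean x \<partial>tilted_law) =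
          (\<integral>x. indicator B x * ((\<Sum>i<n. x i) / n) - indicator B x * seq_mean x \<partial>tilted_law)"
        by (rule Bochner_Integration.integral_diff[symmetric])
          (intro integrable_indicator_mult avg tilted_law_lln(2); simp)+
      also have "\<bar>\<dots>\<bar> \<le> (\<integral>x. \<bar>indicator B x * ((\<Sum>i<n. x i) / n) - indicator B x * seq_mean x\<bar> \<partial>tilted_law)"
        by (rule integral_abs_bound)
      also have "\<dots> \<le> (\<integral>x. \<bar>(\<Sum>i<n. x i) / n - seq_mean x\<bar> \<partial>tilted_law)"
        using avg tilted_law_lln(2)
        by (intro integral_mono integrable_abs Bochner_Integration.integrable_diff integrable_indicator_mult)
          (auto simp: indicator_def)
      finally show "\<bar>(\<integral>x. indicator B x * ((\<Sum>i<n. x i) / n) \<partial>tilted_law) - (\<integral>x. indicator B x * seq_mean x \<partial>tilted_law)\<bar>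
          \<le> (\<integral>x. \<bar>(\<Sum>i<n. x i) / n - seq_mean x\<bar> \<partial>tilted_law)" .
    qed
  qed simp
  moreover have "\<forall>\<^sub>F n in sequentially. (\<integral>x. indicator B x * ((\<Sum>i<n. x i) / n) \<partial>tilted_law) = (\<integral>x. indicator B x * x 0 \<partial>tilted_law)"
  proof (rule eventually_sequentiallyI[of 1])
    fix n :: nat assume "1 \<le> n"
    have "(\<integral>x. indicator B x * ((\<Sum>i<n. x i) / n) \<partial>tilted_law) = (\<integral>x. (\<Sum>i<n. indicator B x * x i) / n \<partial>tilted_law)"
      by (simp add: sum_distrib_left)
    also have "\<dots> = (\<Sum>i<n. \<integral>x. indicator B x * x i \<partial>tilted_law) / n"
      by (simp only: integral_divide_zero Bochner_Integration.integral_sum[OF int])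
    also have "\<dots> = (\<Sum>i<n. \<integral>x. indicator B x * x 0 \<partial>tilted_law) / n"
      by (intro arg_cong2[where f="(/)"] sum.cong refl coord)
    also have "\<dots> = (\<integral>x. indicator B x * x 0 \<partial>tilted_law)"
      using \<open>1 \<le> n\<close> by simp
    finally show "(\<integral>x. indicator B x * ((\<Sum>i<n. x i) / n) \<partial>tilted_law) = (\<integral>x. indicator B x * x 0 \<partial>tilted_law)" .
  qed
  then have "(\<lambda>n. \<integral>x. indicator B x * ((\<Sum>i<n. x i) / n) \<partial>tilted_law) \<longlonglongrightarrow> (\<integral>x. indicator B x * x 0 \<partial>tilted_law)"
    by (rule tendsto_eventually)
  ultimately show ?thesis
    by (rule LIMSEQ_unique)
qed

section \<open>The limit as a quotient of conditional expectations\<close>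

definition limit_ratio :: "'a \<Rightarrow> real" where
  "limit_ratio \<omega> = seq_mean (\<lambda>i. ratio i \<omega>)"

lemma measurable_limit_ratio: "limit_ratio \<in> borel_measurable (perm_invariant_field M ratio)"
proof (rule measurableI)
  fix B :: "real set" assume [measurable]: "B \<in> sets borel"
  have "seq_mean -` B \<in> sets (\<Pi>\<^sub>M i\<in>UNIV. borel)"
    using measurable_sets[OF seq_mean_measurable, of B] by (simp add: space_PiM)
  then have "seq_mean -` B \<in> perm_invariant_sets"
    by (auto simp: perm_invariant_sets_def seq_mean_permute)
  then show "limit_ratio -` B \<inter> space (perm_invariant_field M ratio) \<in> sets (perm_invariant_field M ratio)"
    by (auto simp: sets_perm_invariant_field limit_ratio_def intro!: exI[of _ "seq_mean -` B"])
qed simp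

lemma measurable_limit_ratio' [measurable]: "limit_ratio \<in> borel_measurable M"
  unfolding limit_ratio_def[abs_def] by measurable

lemma integrable_\<xi>_limit_ratio: "integrable M (\<lambda>\<omega>. \<xi> 0 \<omega> * limit_ratio \<omega>)"
  using tilted_law_lln(2) by (simp add: integrable_tilted_law limit_ratio_def)

text \<open>On an event A of F, both \<xi> 1 and \<open>limit_ratio\<close> times \<xi> 0 integrate
  to weighted integrals over the corresponding \<open>B\<close>, and these agree by
  \<open>integral_tilted_law_seq_mean\<close>. As \<open>limit_ratio\<close> is F-measurable, it can
  be pulled out of the conditional expectation.\<close>

lemma cond_exp_limit_ratio:
  defines "F \<equiv> perm_invariant_field M ratio"
  shows "AE \<omega> in M. \<xi> 0 \<omega> / real_cond_exp M F (\<xi> 0) \<omega> * real_cond_exp M F (\<xi> 1) \<omega> = \<xi> 0 \<omega> * limit_ratio \<omega>"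
proof -
  have "finite_measure_subalgebra M F"
    unfolding F_def finite_measure_subalgebra_def finite_measure_subalgebra_axioms_def
    by (intro conjI finite_measure_axioms subalgebra_perm_invariant_field) simp
  then interpret finite_measure_subalgebra M F .
  have "AE \<omega> in M. real_cond_exp M F (\<xi> 1) \<omega> = limit_ratio \<omega> * real_cond_exp M F (\<xi> 0) \<omega>"
  proof (rule real_cond_exp_charact)
    have comm: "integrable M (\<lambda>\<omega>. limit_ratio \<omega> * \<xi> 0 \<omega>)"
      using integrable_\<xi>_limit_ratio by (simp add: mult.commute)
    have lim_meas: "limit_ratio \<in> borel_measurable F"
      unfolding F_def by (rule measurable_limit_ratio)
    have mult: "AE \<omega> in M. real_cond_exp M F (\<lambda>\<omega>. limit_ratio \<omega> * \<xi> 0 \<omega>) \<omega> = limit_ratio \<omega> * real_cond_exp M F (\<xi> 0) \<omega>"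
      by (rule real_cond_exp_mult[OF lim_meas measurable_\<xi> comm])
    show "(\<lambda>\<omega>. limit_ratio \<omega> * real_cond_exp M F (\<xi> 0) \<omega>) \<in> borel_measurable F"
      using lim_meas by simp
    then have [measurable]: "(\<lambda>\<omega>. limit_ratio \<omega> * real_cond_exp M F (\<xi> 0) \<omega>) \<in> borel_measurable M"
      by (rule measurable_from_subalg[OF subalg])
    show "integrable M (\<lambda>\<omega>. limit_ratio \<omega> * real_cond_exp M F (\<xi> 0) \<omega>)"
      using real_cond_exp_int(1)[OF comm] mult by (subst integrable_cong_AE[OF _ _ AE_symmetric[OF mult]]) auto
    fix A assume A: "A \<in> sets F"
    then obtain B where B: "B \<in> perm_invariant_sets" "A = (\<lambda>\<omega> i. ratio i \<omega>) -` B \<inter> space M"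
      by (auto simp: F_def sets_perm_invariant_field)
    have [measurable]: "B \<in> sets (\<Pi>\<^sub>M i\<in>UNIV. borel)"
      using B by (simp add: perm_invariant_sets_def)
    have [measurable]: "A \<in> sets M"
      using A subalg by (auto simp: subalgebra_def)
    have ind: "indicator A \<omega> = (indicator B (\<lambda>i. ratio i \<omega>) :: real)" if "\<omega> \<in> space M" for \<omega>
      using that by (auto simp: B(2) indicator_def)
    have "(\<integral>\<omega>\<in>A. \<xi> 1 \<omega> \<partial>M) = (\<integral>\<omega>. \<xi> 0 \<omega> * (indicator B (\<lambda>i. ratio i \<omega>) * ratio 0 \<omega>) \<partial>M)"
      unfolding set_lebesgue_integral_def
    proof (rule integral_cong_AE)
      show "AE \<omega> in M. indicat_real A \<omega> *\<^sub>R \<xi> 1 \<omega> = \<xi> 0 \<omega> * (indicator B (\<lambda>i. ratio i \<omega>) * ratio 0 \<omega>)"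
        using \<xi>_0_ratio[of 0] AE_space by eventually_elim (simp add: ind)
    qed measurable
    also have "\<dots> = (\<integral>x. indicator B x * x 0 \<partial>tilted_law)"
      by (subst integral_tilted_law) auto
    also have "\<dots> = (\<integral>x. indicator B x * seq_mean x \<partial>tilted_law)"
      by (rule integral_tilted_law_seq_mean[OF B(1), symmetric])
    also have "\<dots> = (\<integral>\<omega>. \<xi> 0 \<omega> * (indicator B (\<lambda>i. ratio i \<omega>) * limit_ratio \<omega>) \<partial>M)"
      by (subst integral_tilted_law) (auto simp: limit_ratio_def)
    also have "\<dots> = (\<integral>\<omega>\<in>A. limit_ratio \<omega> * \<xi> 0 \<omega> \<partial>M)"
      unfolding set_lebesgue_integral_def
      by (intro Bochner_Integration.integral_cong) (auto simp: ind)
    also have "\<dots> = (\<integral>\<omega>\<in>A. real_cond_exp M F (\<lambda>\<omega>. limit_ratio \<omega> * \<xi> 0 \<omega>) \<omega> \<partial>M)"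
      by (rule real_cond_exp_intA[OF comm A])
    also have "\<dots> = (\<integral>\<omega>\<in>A. limit_ratio \<omega> * real_cond_exp M F (\<xi> 0) \<omega> \<partial>M)"
      unfolding set_lebesgue_integral_def using mult
      by (intro integral_cong_AE) (auto elim!: eventually_mono)
    finally show "(\<integral>\<omega>\<in>A. \<xi> 1 \<omega> \<partial>M) = (\<integral>\<omega>\<in>A. limit_ratio \<omega> * real_cond_exp M F (\<xi> 0) \<omega> \<partial>M)" .
  qed (rule integrable_\<xi>)
  \<comment> \<open>Strict positivity passes to the conditional expectation and allows the
    division.\<close>
  moreover have "AE \<omega> in M. 0 < real_cond_exp M F (\<xi> 0) \<omega>"
    by (rule real_cond_exp_gr_c[OF integrable_\<xi> pos])
  ultimately show ?thesis
    by eventually_elim simp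
qed

section \<open>Return to the averages of the original sequence\<close>

lemma AE_mean_tendsto: "AE \<omega> in M. (\<lambda>n. 1 / real n * (\<Sum>i<n. \<xi> i \<omega>)) \<longlonglongrightarrow> \<xi> 0 \<omega> * limit_ratio \<omega>"
proof -
  have "AE \<omega> in M. (\<lambda>n. (\<Sum>i<n. ratio i \<omega>) / n) \<longlonglongrightarrow> limit_ratio \<omega>"
    using tilted_law_lln(1) by (subst (asm) AE_tilted_law_iff) (auto simp: limit_ratio_def)
  then show ?thesis
    using pos[of 0]
  proof eventually_elim
    case (elim \<omega>)
    \<comment> \<open>The mean of n + 1 terms consists of \<open>\<xi> 0\<close> itself, which gives
      the summand \<open>1 / real (Suc n)\<close>, and of n terms that are \<open>\<xi> 0\<close>
      times ratios.\<close>
    have "(\<lambda>n. \<xi> 0 \<omega> * (1 / real (Suc n) + real n / real (Suc n) * ((\<Sum>i<n. ratio i \<omega>) / n))) \<longlonglongrightarrow> \<xi> 0 \<omega> * (0 + 1 * limit_ratio \<omega>)"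
      using lim_inverse_n' LIMSEQ_Suc[OF lim_inverse_n'] LIMSEQ_n_over_Suc_n
      by (intro tendsto_intros elim) (simp_all add: divide_inverse)
    moreover have "\<xi> 0 \<omega> * (1 / real (Suc n) + real n / real (Suc n) * ((\<Sum>i<n. ratio i \<omega>) / n)) = 1 / real (Suc n) * (\<Sum>i<Suc n. \<xi> i \<omega>)" for n
    proof -
      have "\<xi> 0 \<omega> * (\<Sum>i<n. ratio i \<omega>) = (\<Sum>i<n. \<xi> (Suc i) \<omega>)"
        using elim by (simp add: sum_distrib_left ratio_def)
      moreover have "real n / real (Suc n) * ((\<Sum>i<n. ratio i \<omega>) / n) = (\<Sum>i<n. ratio i \<omega>) / real (Suc n)"
        by (cases "n = 0") simp_all
      ultimately show ?thesis
        by (simp add: sum.lessThan_Suc_shift add_divide_distrib distrib_left del: sum.lessThan_Suc)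
    qed
    ultimately have "(\<lambda>n. 1 / real (Suc n) * (\<Sum>i<Suc n. \<xi> i \<omega>)) \<longlonglongrightarrow> \<xi> 0 \<omega> * limit_ratio \<omega>"
      by (simp only: add_0 mult_1)
    then show ?case
      by (rule LIMSEQ_imp_Suc)
  qed
qed

text \<open>Swap-invariance is tested with the unit vector of coordinate 0; positivity removes the
  absolute value.\<close>

lemma expectation_\<xi>: "(\<integral>\<omega>. \<xi> i \<omega> \<partial>M) = (\<integral>\<omega>. \<xi> 0 \<omega> \<partial>M)"
proof -
  have abs: "(\<integral>\<omega>. \<xi> j \<omega> \<partial>M) = (\<integral>\<omega>. \<bar>\<xi> j \<omega>\<bar> \<partial>M)" for j
    using pos[of j] by (intro integral_cong_AE) (auto elim!: eventually_mono)
  let ?u = "\<lambda>j. of_bool (j = 0) :: real"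
  have "Transposition.transpose 0 i permutes {..<Suc i}"
    by (rule permutes_swap_id) auto
  from swap_invariant_seq_permute[OF swap_invariant this, of ?u]
  have "(\<integral>\<omega>. \<bar>\<Sum>j<Suc i. ?u j * \<xi> (Transposition.transpose 0 i j) \<omega>\<bar> \<partial>M) = (\<integral>\<omega>. \<bar>\<Sum>j<Suc i. ?u j * \<xi> j \<omega>\<bar> \<partial>M)" .
  moreover have "(\<Sum>j<Suc i. ?u j * g j) = g 0" for g
    by (simp add: sum.lessThan_Suc_shift del: sum.lessThan_Suc)
  ultimately show ?thesis
    by (simp only: abs transpose_apply_first)
qed

text \<open>The weighted L^1 error \<open>?e n\<close> equals the L^1 error of the mean of \<xi> 1,
  ..., \<xi> n. The mean of \<xi> 0, ..., \<xi> (n - 1) differs from that one by (\<xi> 0 - \<xi> n)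
  / n, whose L^1 norm is at most 2 c / n with c the common expectation.\<close>

lemma tendsto_L1_mean: "tendsto_L1 M (\<lambda>n \<omega>. 1 / real n * (\<Sum>i<n. \<xi> i \<omega>)) (\<lambda>\<omega>. \<xi> 0 \<omega> * limit_ratio \<omega>)"
  unfolding tendsto_L1_def
proof (intro conjI allI)
  show mean: "integrable M (\<lambda>\<omega>. 1 / real n * (\<Sum>i<n. \<xi> i \<omega>))" for n
    by (intro integrable_mult_right Bochner_Integration.integrable_sum integrable_\<xi>)
  show lim: "integrable M (\<lambda>\<omega>. \<xi> 0 \<omega> * limit_ratio \<omega>)"
    by (rule integrable_\<xi>_limit_ratio)
  let ?c = "\<integral>\<omega>. \<xi> 0 \<omega> \<partial>M"
  let ?e = "\<lambda>n. \<integral>x. \<bar>(\<Sum>i<n. x i) / n - seq_mean x\<bar> \<partial>tilted_law"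
  have e_eq: "?e n = (\<integral>\<omega>. \<bar>1 / n * (\<Sum>i<n. \<xi> (Suc i) \<omega>) - \<xi> 0 \<omega> * limit_ratio \<omega>\<bar> \<partial>M)" for n
  proof (subst integral_tilted_law)
    show "(\<integral>\<omega>. \<xi> 0 \<omega> * \<bar>(\<Sum>i<n. ratio i \<omega>) / n - seq_mean (\<lambda>i. ratio i \<omega>)\<bar> \<partial>M) =
        (\<integral>\<omega>. \<bar>1 / n * (\<Sum>i<n. \<xi> (Suc i) \<omega>) - \<xi> 0 \<omega> * limit_ratio \<omega>\<bar> \<partial>M)"
    proof (rule integral_cong_AE)
      show "AE \<omega> in M. \<xi> 0 \<omega> * \<bar>(\<Sum>i<n. ratio i \<omega>) / n - seq_mean (\<lambda>i. ratio i \<omega>)\<bar> =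
          \<bar>1 / n * (\<Sum>i<n. \<xi> (Suc i) \<omega>) - \<xi> 0 \<omega> * limit_ratio \<omega>\<bar>"
        using pos[of 0]
      proof eventually_elim
        case (elim \<omega>)
        have "\<xi> 0 \<omega> * (\<Sum>i<n. ratio i \<omega>) = (\<Sum>i<n. \<xi> (Suc i) \<omega>)"
          using elim by (simp add: sum_distrib_left ratio_def)
        then have "1 / n * (\<Sum>i<n. \<xi> (Suc i) \<omega>) - \<xi> 0 \<omega> * limit_ratio \<omega> =
            \<xi> 0 \<omega> * ((\<Sum>i<n. ratio i \<omega>) / n - seq_mean (\<lambda>i. ratio i \<omega>))"
          by (simp add: right_diff_distrib limit_ratio_def)
        then show ?case
          using elim by (simp add: abs_mult)
      qed
    qed measurable
  qed measurable
  show "(\<lambda>n. \<integral>\<omega>. \<bar>1 / real n * (\<Sum>i<n. \<xi> i \<omega>) - \<xi> 0 \<omega> * limit_ratio \<omega>\<bar> \<partial>M) \<longlonglongrightarrow> 0"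
  proof (rule tendsto_sandwich[OF _ _ tendsto_const])
    show "(\<lambda>n. 2 * ?c * (1 / real n) + ?e n) \<longlonglongrightarrow> 0"
      using tendsto_add[OF tendsto_mult[OF tendsto_const[of "2 * ?c"] lim_1_over_n] tilted_law_lln(3)] by simp
    show "\<forall>\<^sub>F n in sequentially. (\<integral>\<omega>. \<bar>1 / real n * (\<Sum>i<n. \<xi> i \<omega>) - \<xi> 0 \<omega> * limit_ratio \<omega>\<bar> \<partial>M) \<le> 2 * ?c * (1 / real n) + ?e n"
    proof (rule always_eventually, rule allI)
      fix n
      let ?a = "\<lambda>\<omega>. 1 / n * (\<Sum>i<n. \<xi> (Suc i) \<omega>) - \<xi> 0 \<omega> * limit_ratio \<omega>"
      have a: "integrable M (\<lambda>\<omega>. \<bar>?a \<omega>\<bar>)"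
        by (intro integrable_abs Bochner_Integration.integrable_diff integrable_mult_right
            Bochner_Integration.integrable_sum integrable_\<xi> lim)
      have "(\<integral>\<omega>. \<bar>1 / n * (\<Sum>i<n. \<xi> i \<omega>) - \<xi> 0 \<omega> * limit_ratio \<omega>\<bar> \<partial>M) \<le>
          (\<integral>\<omega>. \<xi> 0 \<omega> * (1 / n) + \<xi> n \<omega> * (1 / n) + \<bar>?a \<omega>\<bar> \<partial>M)"
      proof (rule integral_mono_AE)
        show "AE \<omega> in M. \<bar>1 / n * (\<Sum>i<n. \<xi> i \<omega>) - \<xi> 0 \<omega> * limit_ratio \<omega>\<bar> \<le> \<xi> 0 \<omega> * (1 / n) + \<xi> n \<omega> * (1 / n) + \<bar>?a \<omega>\<bar>"
          using pos[of 0] pos[of n]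
        proof eventually_elim
          case (elim \<omega>)
          have "(\<Sum>i<n. \<xi> i \<omega>) = \<xi> 0 \<omega> - \<xi> n \<omega> + (\<Sum>i<n. \<xi> (Suc i) \<omega>)"
            using sum_lessThan_telescope[of "\<lambda>i. \<xi> i \<omega>" n] by (simp add: sum_subtractf)
          then have "1 / n * (\<Sum>i<n. \<xi> i \<omega>) - \<xi> 0 \<omega> * limit_ratio \<omega> = \<xi> 0 \<omega> * (1 / n) - \<xi> n \<omega> * (1 / n) + ?a \<omega>"
            by (simp add: add_divide_distrib diff_divide_distrib)
          moreover have "0 \<le> \<xi> 0 \<omega> * (1 / n)" "0 \<le> \<xi> n \<omega> * (1 / n)"
            using elim by simp_all
          ultimately show ?case
            by linarith
        qed
      qed (use mean lim a integrable_\<xi> in auto)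
      also have "\<dots> = 2 * ?c * (1 / n) + (\<integral>\<omega>. \<bar>?a \<omega>\<bar> \<partial>M)"
        using a integrable_\<xi> expectation_\<xi>[of n] by simp
      finally show "(\<integral>\<omega>. \<bar>1 / n * (\<Sum>i<n. \<xi> i \<omega>) - \<xi> 0 \<omega> * limit_ratio \<omega>\<bar> \<partial>M) \<le> 2 * ?c * (1 / n) + ?e n"
        by (simp only: e_eq)
    qed
  qed auto
qed

end

lemma tendsto_L1_cong_AE:
  assumes "tendsto_L1 M X Y" "AE \<omega> in M. Y \<omega> = Z \<omega>" and Z: "Z \<in> borel_measurable M"
  shows "tendsto_L1 M X Z"
proof -
  have X: "\<And>n. X n \<in> borel_measurable M" and Y: "Y \<in> borel_measurable M"
    using assms(1) by (auto simp: tendsto_L1_def)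
  have "(\<integral>\<omega>. \<bar>X n \<omega> - Y \<omega>\<bar> \<partial>M) = (\<integral>\<omega>. \<bar>X n \<omega> - Z \<omega>\<bar> \<partial>M)" for n
    using assms(2) X[of n] Y Z by (intro integral_cong_AE) (auto elim!: eventually_mono)
  moreover have "integrable M Z"
    using integrable_cong_AE[OF Y Z assms(2)] assms(1) by (simp add: tendsto_L1_def)
  ultimately show ?thesis
    using assms(1) by (simp add: tendsto_L1_def)
qed

theorem proposition22:
  fixes M :: "'a measure" and \<xi> \<xi>' :: "nat \<Rightarrow> 'a \<Rightarrow> real" and L :: "'a \<Rightarrow> real"
  assumes "prob_space M"
    and "swap_invariant_seq M \<xi>"
    and "\<And>i. AE \<omega> in M. 0 < \<xi> i \<omega>"
  defines "\<xi>' \<equiv> (\<lambda>i \<omega>. \<xi> (Suc i) \<omega> / \<xi> 0 \<omega>)"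
  defines "L \<equiv> (\<lambda>\<omega>. \<xi> 0 \<omega> / real_cond_exp M (perm_invariant_field M \<xi>') (\<xi> 0) \<omega>
                    * real_cond_exp M (perm_invariant_field M \<xi>') (\<xi> 1) \<omega>)"
  shows "(AE \<omega> in M. (\<lambda>n. 1 / real n * (\<Sum>i<n. \<xi> i \<omega>)) \<longlonglongrightarrow> L \<omega>) \<and>
         tendsto_L1 M (\<lambda>n \<omega>. 1 / real n * (\<Sum>i<n. \<xi> i \<omega>)) L"
proof -
  interpret positive_swap_invariant M \<xi>
    using assms(1-3) by (simp add: positive_swap_invariant_def positive_swap_invariant_axioms_def)
  have \<xi>': "\<xi>' = ratio"
    by (simp add: \<xi>'_def ratio_def fun_eq_iff)
  have L: "AE \<omega> in M. \<xi> 0 \<omega> * limit_ratio \<omega> = L \<omega>"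
    using cond_exp_limit_ratio unfolding L_def \<xi>' by eventually_elim simp
  have meas: "L \<in> borel_measurable M"
    unfolding L_def by simp
  show ?thesis
  proof
    show "AE \<omega> in M. (\<lambda>n. 1 / real n * (\<Sum>i<n. \<xi> i \<omega>)) \<longlonglongrightarrow> L \<omega>"
      using AE_mean_tendsto L by eventually_elim simp
    show "tendsto_L1 M (\<lambda>n \<omega>. 1 / real n * (\<Sum>i<n. \<xi> i \<omega>)) L"
      by (rule tendsto_L1_cong_AE[OF tendsto_L1_mean L meas])
  qed
qed

end
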